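(* Let $\mathcal{E}$ and $\mathcal{C}$ be categories, let $\mathbb{G} = \mathcal{C}^{-1}\mathcal{C}$ be the groupoid obtained from $\mathcal{C}$ by formally inverting all maps, let $\gamma : \mathcal{C} \to \mathbb{G}$ be the localisation functor, and let $\gamma^* : \mathcal{E}^{\mathbb{G}} \to \mathcal{E}^{\mathcal{C}}$ be precomposition with $\gamma$. Let $h : B \to A$ be a map in $\mathcal{E}^{\mathbb{G}}$ such that each component $h_x : Bx \to Ax$ is powerful in $\mathcal{E}$. Then for every $k : C \to B$ in $\mathcal{E}^{\mathbb{G}}/B$, the dependent product $\Pi_B k : \Pi_B C \to A$ exists in $\mathcal{E}^{\mathbb{G}}/A$. Moreover, the dependent product $\Pi_{\gamma^*B}\gamma^*k : \Pi_{\gamma^*B}\gamma^*C \to \gamma^*A$ (of $\gamma^*k$ along $\gamma^*h$) exists in $\mathcal{E}^{\mathcal{C}}/\gamma^*A$ and is isomorphic to $\gamma^*(\Pi_B k) : \gamma^*(\Pi_B C) \to \gamma^*A$ in $\mathcal{E}^{\mathcal{C}}/\gamma^*A$.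
   Context: A map $f : c \to d$ in a category is *powerful* if pullbacks along $f$ exist and the pullback functor $f^*$ (from the slice over $d$ to the slice over $c$) admits a right adjoint. For a map $f : B \to A$ in a category $\mathcal{D}$ along which pullbacks exist and $k : C \to B$ in $\mathcal{D}/B$, the *dependent product* $\Pi_B k : \Pi_B C \to A$ of $k$ along $f$ is an object of $\mathcal{D}/A$ representing the functor $(\mathcal{D}/A)^{\mathrm{op}} \to \mathrm{Set}$, $D \mapsto (\mathcal{D}/B)(D \times_A B, C)$; when it exists for all $k$ it is the value at $k$ of the right adjoint $\Pi_B$ to $f^*$. $\mathcal{E}^{\mathcal{D}}$ denotes the category of functors $\mathcal{D} \to \mathcal{E}$. *)

theory Defs
  imports Main "HOL-Library.FuncSet"
begin

section \<open>Categories and functors\<close>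

text \<open>
  Objects and arrows are carved out of types by carrier sets. Composition is written in
  applicative order and is only constrained on composable pairs. There are no size conditions.
\<close>

record ('o, 'm) cat =
  Ob :: "'o set"
  Ar :: "'m set"
  Dom :: "'m \<Rightarrow> 'o"
  Cod :: "'m \<Rightarrow> 'o"
  Ident :: "'o \<Rightarrow> 'm"
  Comp :: "'m \<Rightarrow> 'm \<Rightarrow> 'm"  (infixr \<open>\<cdot>\<index>\<close> 70)

definition hom :: "('o, 'm) cat \<Rightarrow> 'o \<Rightarrow> 'o \<Rightarrow> 'm set" where
  "hom X a b = {f \<in> Ar X. Dom X f = a \<and> Cod X f = b}"

definition category :: "('o, 'm) cat \<Rightarrow> bool" where
  "category X \<longleftrightarrow>
     (\<forall>f\<in>Ar X. Dom X f \<in> Ob X \<and> Cod X f \<in> Ob X) \<and>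
     (\<forall>a\<in>Ob X. Ident X a \<in> hom X a a) \<and>
     (\<forall>a b c f g. f \<in> hom X a b \<and> g \<in> hom X b c \<longrightarrow> g \<cdot>\<^bsub>X\<^esub> f \<in> hom X a c) \<and>
     (\<forall>a b f. f \<in> hom X a b \<longrightarrow> f \<cdot>\<^bsub>X\<^esub> Ident X a = f \<and> Ident X b \<cdot>\<^bsub>X\<^esub> f = f) \<and>
     (\<forall>a b c d f g h. f \<in> hom X a b \<and> g \<in> hom X b c \<and> h \<in> hom X c d \<longrightarrow>
        h \<cdot>\<^bsub>X\<^esub> (g \<cdot>\<^bsub>X\<^esub> f) = (h \<cdot>\<^bsub>X\<^esub> g) \<cdot>\<^bsub>X\<^esub> f)"

definition inverse_arrows :: "('o, 'm) cat \<Rightarrow> 'm \<Rightarrow> 'm \<Rightarrow> bool" where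
  "inverse_arrows X u v \<longleftrightarrow> u \<in> Ar X \<and> v \<in> hom X (Cod X u) (Dom X u) \<and>
     v \<cdot>\<^bsub>X\<^esub> u = Ident X (Dom X u) \<and> u \<cdot>\<^bsub>X\<^esub> v = Ident X (Cod X u)"

definition isomorphic :: "('o, 'm) cat \<Rightarrow> 'o \<Rightarrow> 'o \<Rightarrow> bool" where
  "isomorphic X a b \<longleftrightarrow> (\<exists>u v. u \<in> hom X a b \<and> inverse_arrows X u v)"

text \<open>
  The two maps of a functor are required to be \<^const>\<open>undefined\<close> off the carriers, so that
  equality of functors is equality in HOL; likewise for natural transformations below.
\<close>

record ('o, 'm, 'p, 'n) func =
  fob :: "'o \<Rightarrow> 'p"
  far :: "'m \<Rightarrow> 'n"

definition is_functor ::
    "('o, 'm) cat \<Rightarrow> ('p, 'n) cat \<Rightarrow> ('o, 'm, 'p, 'n) func \<Rightarrow> bool" where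
  "is_functor X Y F \<longleftrightarrow>
     fob F \<in> extensional (Ob X) \<and> far F \<in> extensional (Ar X) \<and>
     (\<forall>a\<in>Ob X. fob F a \<in> Ob Y) \<and>
     (\<forall>a b f. f \<in> hom X a b \<longrightarrow> far F f \<in> hom Y (fob F a) (fob F b)) \<and>
     (\<forall>a\<in>Ob X. far F (Ident X a) = Ident Y (fob F a)) \<and>
     (\<forall>a b c f g. f \<in> hom X a b \<and> g \<in> hom X b c \<longrightarrow>
        far F (g \<cdot>\<^bsub>X\<^esub> f) = far F g \<cdot>\<^bsub>Y\<^esub> far F f)"

definition functor_comp ::
    "('o, 'm) cat \<Rightarrow> ('p, 'n, 'q, 'k) func \<Rightarrow> ('o, 'm, 'p, 'n) func \<Rightarrow> ('o, 'm, 'q, 'k) func" where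
  "functor_comp X G F =
     \<lparr>fob = \<lambda>a\<in>Ob X. fob G (fob F a), far = \<lambda>f\<in>Ar X. far G (far F f)\<rparr>"


section \<open>Functor categories and precomposition\<close>

definition nat_trans :: "('o, 'm) cat \<Rightarrow> ('p, 'n) cat \<Rightarrow> ('o, 'm, 'p, 'n) func \<Rightarrow>
    ('o, 'm, 'p, 'n) func \<Rightarrow> ('o \<Rightarrow> 'n) \<Rightarrow> bool" where
  "nat_trans X Y F G \<eta> \<longleftrightarrow>
     is_functor X Y F \<and> is_functor X Y G \<and> \<eta> \<in> extensional (Ob X) \<and>
     (\<forall>a\<in>Ob X. \<eta> a \<in> hom Y (fob F a) (fob G a)) \<and>
     (\<forall>a b f. f \<in> hom X a b \<longrightarrow> \<eta> b \<cdot>\<^bsub>Y\<^esub> far F f = far G f \<cdot>\<^bsub>Y\<^esub> \<eta> a)"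

type_synonym ('o, 'm, 'p, 'n) nat_tr =
  "('o, 'm, 'p, 'n) func \<times> ('o, 'm, 'p, 'n) func \<times> ('o \<Rightarrow> 'n)"

definition component :: "('o, 'm, 'p, 'n) nat_tr \<Rightarrow> 'o \<Rightarrow> 'n" where
  "component = (\<lambda>(F, G, \<eta>). \<eta>)"

definition functor_cat :: "('o, 'm) cat \<Rightarrow> ('p, 'n) cat \<Rightarrow>
    (('o, 'm, 'p, 'n) func, ('o, 'm, 'p, 'n) nat_tr) cat" where
  "functor_cat X Y =
     \<lparr>Ob = {F. is_functor X Y F},
      Ar = {(F, G, \<eta>). nat_trans X Y F G \<eta>},
      Dom = (\<lambda>(F, G, \<eta>). F),
      Cod = (\<lambda>(F, G, \<eta>). G),
      Ident = (\<lambda>F. (F, F, \<lambda>a\<in>Ob X. Ident Y (fob F a))),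
      Comp = (\<lambda>(G', H, \<theta>) (F, G, \<eta>). (F, H, \<lambda>a\<in>Ob X. \<theta> a \<cdot>\<^bsub>Y\<^esub> \<eta> a))\<rparr>"

text \<open>For \<open>K\<close> a functor from \<open>X\<close> to \<open>X'\<close>, the functor \<open>K\<^sup>*\<close> from \<open>Y\<^bsup>X'\<^esup>\<close> to \<open>Y\<^bsup>X\<^esup>\<close>.\<close>

definition precompose :: "('o, 'm) cat \<Rightarrow> ('o', 'm') cat \<Rightarrow> ('p, 'n) cat \<Rightarrow>
    ('o, 'm, 'o', 'm') func \<Rightarrow>
    (('o', 'm', 'p, 'n) func, ('o', 'm', 'p, 'n) nat_tr,
     ('o, 'm, 'p, 'n) func, ('o, 'm, 'p, 'n) nat_tr) func" where
  "precompose X X' Y K =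
     \<lparr>fob = \<lambda>F\<in>Ob (functor_cat X' Y). functor_comp X F K,
      far = \<lambda>(F, G, \<eta>)\<in>Ar (functor_cat X' Y).
        (functor_comp X F K, functor_comp X G K, \<lambda>a\<in>Ob X. \<eta> (fob K a))\<rparr>"


section \<open>The groupoid obtained by formally inverting all arrows\<close>

text \<open>
  Arrows of the localisation are zigzags of arrows of \<open>X\<close>, read in diagrammatic order, modulo
  the congruence generated by the composition and identities of \<open>X\<close> and by making
  \<open>Bwd f\<close> a two-sided inverse of \<open>Fwd f\<close>.
\<close>

datatype 'm step = Fwd 'm | Bwd 'm

primrec zigzag :: "('o, 'm) cat \<Rightarrow> 'o \<Rightarrow> 'm step list \<Rightarrow> 'o \<Rightarrow> bool" where
  "zigzag X x [] y \<longleftrightarrow> x \<in> Ob X \<and> x = y"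
| "zigzag X x (s # w) y \<longleftrightarrow>
     (case s of
        Fwd f \<Rightarrow> f \<in> Ar X \<and> Dom X f = x \<and> zigzag X (Cod X f) w y
      | Bwd f \<Rightarrow> f \<in> Ar X \<and> Cod X f = x \<and> zigzag X (Dom X f) w y)"

inductive zz_basic :: "('o, 'm) cat \<Rightarrow> 'm step list \<Rightarrow> 'm step list \<Rightarrow> bool"
  for X :: "('o, 'm) cat" where
  comp: "f \<in> hom X a b \<Longrightarrow> g \<in> hom X b c \<Longrightarrow> zz_basic X [Fwd f, Fwd g] [Fwd (g \<cdot>\<^bsub>X\<^esub> f)]"
| ident: "a \<in> Ob X \<Longrightarrow> zz_basic X [Fwd (Ident X a)] []"
| fwd_bwd: "f \<in> Ar X \<Longrightarrow> zz_basic X [Fwd f, Bwd f] []"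
| bwd_fwd: "f \<in> Ar X \<Longrightarrow> zz_basic X [Bwd f, Fwd f] []"

definition zz_rewrite ::
    "('o, 'm) cat \<Rightarrow> 'o \<Rightarrow> 'o \<Rightarrow> 'm step list \<Rightarrow> 'm step list \<Rightarrow> bool" where
  "zz_rewrite X x y p q \<longleftrightarrow> zigzag X x p y \<and> zigzag X x q y \<and>
     (\<exists>u l r v. zz_basic X l r \<and> p = u @ l @ v \<and> q = u @ r @ v)"

definition zz_class :: "('o, 'm) cat \<Rightarrow> 'o \<Rightarrow> 'm step list \<Rightarrow> 'o \<Rightarrow> 'm step list set" where
  "zz_class X x p y = {q. equivclp (zz_rewrite X x y) p q}"

type_synonym ('o, 'm) zz_arrow = "'o \<times> 'm step list set \<times> 'o"

definition localisation :: "('o, 'm) cat \<Rightarrow> ('o, ('o, 'm) zz_arrow) cat" where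
  "localisation X =
     \<lparr>Ob = Ob X,
      Ar = {(x, zz_class X x p y, y) |x p y. zigzag X x p y},
      Dom = (\<lambda>(x, P, y). x),
      Cod = (\<lambda>(x, P, y). y),
      Ident = (\<lambda>x. (x, zz_class X x [] x, x)),
      Comp = (\<lambda>(y', Q, z) (x, P, y). (x, \<Union>p\<in>P. \<Union>q\<in>Q. zz_class X x (p @ q) z, z))\<rparr>"

definition localisation_functor ::
    "('o, 'm) cat \<Rightarrow> ('o, 'm, 'o, ('o, 'm) zz_arrow) func" where
  "localisation_functor X =
     \<lparr>fob = \<lambda>x\<in>Ob X. x,
      far = \<lambda>f\<in>Ar X. (Dom X f, zz_class X (Dom X f) [Fwd f] (Cod X f), Cod X f)\<rparr>"


section \<open>Slices, pullbacks, powerful maps and dependent products\<close>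

text \<open>An arrow of a slice is recorded together with its domain and codomain.\<close>

definition slice :: "('o, 'm) cat \<Rightarrow> 'o \<Rightarrow> ('m, 'm \<times> 'm \<times> 'm) cat" where
  "slice X a =
     \<lparr>Ob = {f \<in> Ar X. Cod X f = a},
      Ar = {(f, g, u). f \<in> Ar X \<and> Cod X f = a \<and> g \<in> Ar X \<and> Cod X g = a \<and>
              u \<in> hom X (Dom X f) (Dom X g) \<and> g \<cdot>\<^bsub>X\<^esub> u = f},
      Dom = (\<lambda>(f, g, u). f),
      Cod = (\<lambda>(f, g, u). g),
      Ident = (\<lambda>f. (f, f, Ident X (Dom X f))),
      Comp = (\<lambda>(g', h, v) (f, g, u). (f, h, v \<cdot>\<^bsub>X\<^esub> u))\<rparr>"

definition is_pullback :: "('o, 'm) cat \<Rightarrow> 'm \<Rightarrow> 'm \<Rightarrow> 'm \<Rightarrow> 'm \<Rightarrow> bool" where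
  "is_pullback X f g p q \<longleftrightarrow>
     f \<in> Ar X \<and> g \<in> Ar X \<and> Cod X f = Cod X g \<and>
     p \<in> Ar X \<and> q \<in> hom X (Dom X p) (Dom X g) \<and> Cod X p = Dom X f \<and>
     f \<cdot>\<^bsub>X\<^esub> p = g \<cdot>\<^bsub>X\<^esub> q \<and>
     (\<forall>w p' q'. p' \<in> hom X w (Dom X f) \<and> q' \<in> hom X w (Dom X g) \<and>
        f \<cdot>\<^bsub>X\<^esub> p' = g \<cdot>\<^bsub>X\<^esub> q' \<longrightarrow>
        (\<exists>!u. u \<in> hom X w (Dom X p) \<and> p \<cdot>\<^bsub>X\<^esub> u = p' \<and> q \<cdot>\<^bsub>X\<^esub> u = q'))"

definition pullbacks_along :: "('o, 'm) cat \<Rightarrow> 'm \<Rightarrow> bool" where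
  "pullbacks_along X f \<longleftrightarrow> f \<in> Ar X \<and>
     (\<forall>g\<in>Ar X. Cod X g = Cod X f \<longrightarrow> (\<exists>p q. is_pullback X f g p q))"

definition chosen_pullback :: "('o, 'm) cat \<Rightarrow> 'm \<Rightarrow> 'm \<Rightarrow> 'm \<times> 'm" where
  "chosen_pullback X f g = (SOME (p, q). is_pullback X f g p q)"

text \<open>
  The functor \<open>f\<^sup>*\<close> from the slice over the codomain of \<open>f\<close> to the slice over its domain;
  meaningful when pullbacks along \<open>f\<close> exist. Pullbacks are fixed by Hilbert choice; any other
  choice gives a naturally isomorphic functor.
\<close>

definition pullback_functor ::
    "('o, 'm) cat \<Rightarrow> 'm \<Rightarrow> ('m, 'm \<times> 'm \<times> 'm, 'm, 'm \<times> 'm \<times> 'm) func" where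
  "pullback_functor X f =
     \<lparr>fob = \<lambda>g\<in>Ob (slice X (Cod X f)). fst (chosen_pullback X f g),
      far = \<lambda>(g, g', u)\<in>Ar (slice X (Cod X f)).
        (case (chosen_pullback X f g, chosen_pullback X f g') of
          ((p, q), (p', q')) \<Rightarrow>
            (p, p', THE v. v \<in> hom X (Dom X p) (Dom X p') \<and>
                      p' \<cdot>\<^bsub>X\<^esub> v = p \<and> q' \<cdot>\<^bsub>X\<^esub> v = u \<cdot>\<^bsub>X\<^esub> q))\<rparr>"

definition adjoint_functors :: "('o, 'm) cat \<Rightarrow> ('p, 'n) cat \<Rightarrow>
    ('o, 'm, 'p, 'n) func \<Rightarrow> ('p, 'n, 'o, 'm) func \<Rightarrow> bool" where
  "adjoint_functors X Y L R \<longleftrightarrow> is_functor X Y L \<and> is_functor Y X R \<and>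
     (\<exists>\<Phi>. (\<forall>x\<in>Ob X. \<forall>y\<in>Ob Y. bij_betw (\<Phi> x y) (hom Y (fob L x) y) (hom X x (fob R y))) \<and>
          (\<forall>x x' y y' u v s. u \<in> hom X x' x \<and> v \<in> hom Y y y' \<and> s \<in> hom Y (fob L x) y \<longrightarrow>
             \<Phi> x' y' (v \<cdot>\<^bsub>Y\<^esub> s \<cdot>\<^bsub>Y\<^esub> far L u) = far R v \<cdot>\<^bsub>X\<^esub> \<Phi> x y s \<cdot>\<^bsub>X\<^esub> u))"

definition powerful :: "('o, 'm) cat \<Rightarrow> 'm \<Rightarrow> bool" where
  "powerful X f \<longleftrightarrow> f \<in> Ar X \<and> pullbacks_along X f \<and>
     (\<exists>R. adjoint_functors (slice X (Cod X f)) (slice X (Dom X f)) (pullback_functor X f) R)"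

text \<open>\<open>P\<close> represents the functor \<open>D \<mapsto> hom Y (L D) k\<close> from the opposite of \<open>X\<close> to sets.\<close>

definition represents :: "('o, 'm) cat \<Rightarrow> ('p, 'n) cat \<Rightarrow>
    ('o, 'm, 'p, 'n) func \<Rightarrow> 'p \<Rightarrow> 'o \<Rightarrow> bool" where
  "represents X Y L k P \<longleftrightarrow> P \<in> Ob X \<and> k \<in> Ob Y \<and>
     (\<exists>\<Phi>. (\<forall>D\<in>Ob X. bij_betw (\<Phi> D) (hom X D P) (hom Y (fob L D) k)) \<and>
          (\<forall>D D' u s. u \<in> hom X D' D \<and> s \<in> hom X D P \<longrightarrow>
             \<Phi> D' (s \<cdot>\<^bsub>X\<^esub> u) = \<Phi> D s \<cdot>\<^bsub>Y\<^esub> far L u))"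

text \<open>
  \<open>P\<close>, an arrow into the codomain of \<open>f\<close>, represents \<open>D \<mapsto> hom (f\<^sup>* D) k\<close>, where \<open>f\<^sup>* D\<close> is the
  base change of \<open>D\<close> and the hom-set is that of the slice over the domain of \<open>f\<close>.
\<close>

definition dependent_product :: "('o, 'm) cat \<Rightarrow> 'm \<Rightarrow> 'm \<Rightarrow> 'm \<Rightarrow> bool" where
  "dependent_product X f k P \<longleftrightarrow> pullbacks_along X f \<and>
     represents (slice X (Cod X f)) (slice X (Dom X f)) (pullback_functor X f) k P"

end

theory Submission
  imports Defs
begin

text \<open>
  Dependent products along \<open>h\<close> are computed pointwise as soon as the naturality squares of \<open>h\<close> are
  pullbacks: for \<open>f : x \<rightarrow> y\<close>, base change along \<open>h\<^sub>y\<close> of an object over \<open>A x\<close> pushed forward along \<open>A f\<close>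
  then agrees with its base change along \<open>h\<^sub>x\<close>, so the universal properties of the pointwise dependent
  products give both the functorial action and the naturality of transposes. Over the groupoid
  \<open>\<G>\<close> every naturality square is a pullback because \<open>A f\<close> and \<open>B f\<close> are invertible, and the naturality
  squares of \<open>\<gamma>\<^sup>* h\<close> are among those of \<open>h\<close>. Since \<open>\<gamma>\<close> acts as the identity on objects, \<open>\<gamma>\<^sup>*\<close> carries a pointwise
  dependent product to a pointwise dependent product, and uniqueness of representing objects
  does the rest.
\<close>

section \<open>Pullbacks and dependent products in a category\<close>

text \<open>The obstacle is choice. \<open>dependent_product\<close> refers to the pullbacks picked
  by \<open>pullback_functor\<close> inside a functor category, and nothing relates these to the
  pullbacks picked in \<open>\<E>\<close>, nor are they given objectwise. The argument therefore
  runs through \<open>evaluation\<close>: a counit whose universal property is tested against every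
  pullback square. Yoneda's argument translates between this and representing objects.

  For a general \<open>h\<close>, a dependent product in a functor category is not objectwise: its
  value at \<open>x\<close> also sees the arrows out of \<open>x\<close>. Pullback naturality
  squares remove exactly this dependence.

  The evaluations in \<open>\<E>\<close> are chosen independently at each object, with no
  compatibility between them. Every piece of naturality is recovered from uniqueness: two arrows
  agree because both transpose the same map, or because both lift the same cone.\<close>

lemma hom_iff: "f \<in> hom X a b \<longleftrightarrow> f \<in> Ar X \<and> Dom X f = a \<and> Cod X f = b"
  by (simp add: hom_def)

lemma slice_hom_iff:
  "t \<in> hom (slice X a) f g \<longleftrightarrow>
     f \<in> Ar X \<and> Cod X f = a \<and> g \<in> Ar X \<and> Cod X g = a \<and>
     (\<exists>u. t = (f, g, u) \<and> u \<in> hom X (Dom X f) (Dom X g) \<and> g \<cdot>\<^bsub>X\<^esub> u = f)"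
  by (auto simp: hom_def slice_def)

lemma slice_simps [simp]:
  "f \<in> Ob (slice X a) \<longleftrightarrow> f \<in> Ar X \<and> Cod X f = a"
  "(g, h, v) \<cdot>\<^bsub>slice X a\<^esub> (f, g', u) = (f, h, v \<cdot>\<^bsub>X\<^esub> u)"
  "Ident (slice X a) f = (f, f, Ident X (Dom X f))"
  by (auto simp: slice_def)

locale cat =
  fixes X :: "('o, 'm) cat" (structure)
  assumes category: "category X"
begin

lemma Dom_Ob [simp]: "f \<in> Ar X \<Longrightarrow> Dom X f \<in> Ob X"
  and Cod_Ob [simp]: "f \<in> Ar X \<Longrightarrow> Cod X f \<in> Ob X"
  using category by (auto simp: category_def)

lemma hom_Ob: "f \<in> hom X a b \<Longrightarrow> a \<in> Ob X \<and> b \<in> Ob X"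
  by (auto simp: hom_iff)

lemma Ident_hom: "a \<in> Ob X \<Longrightarrow> Ident X a \<in> hom X a a"
  using category by (simp add: category_def)

lemma Ident_simps [simp]:
  assumes "a \<in> Ob X"
  shows "Ident X a \<in> Ar X" "Dom X (Ident X a) = a" "Cod X (Ident X a) = a"
  using Ident_hom[OF assms] by (auto simp: hom_iff)

lemma comp_hom: "f \<in> hom X a b \<Longrightarrow> g \<in> hom X b c \<Longrightarrow> g \<cdot> f \<in> hom X a c"
  using category unfolding category_def by blast

lemma comp_simps [simp]:
  assumes "f \<in> Ar X" "g \<in> Ar X" "Dom X g = Cod X f"
  shows "g \<cdot> f \<in> Ar X" "Dom X (g \<cdot> f) = Dom X f" "Cod X (g \<cdot> f) = Cod X g"
  using comp_hom[of f "Dom X f" "Cod X f" g "Cod X g"] assms by (auto simp: hom_iff)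

lemma comp_Ident [simp]:
  assumes "f \<in> Ar X"
  shows "a = Dom X f \<Longrightarrow> f \<cdot> Ident X a = f" "b = Cod X f \<Longrightarrow> Ident X b \<cdot> f = f"
proof -
  have "f \<in> hom X (Dom X f) (Cod X f)" using assms by (simp add: hom_iff)
  then show "a = Dom X f \<Longrightarrow> f \<cdot> Ident X a = f" "b = Cod X f \<Longrightarrow> Ident X b \<cdot> f = f"
    using category unfolding category_def by blast+
qed

lemma comp_assoc:
  assumes "f \<in> Ar X" "g \<in> Ar X" "h \<in> Ar X" "Dom X g = Cod X f" "Dom X h = Cod X g"
  shows "(h \<cdot> g) \<cdot> f = h \<cdot> (g \<cdot> f)"
proof -
  have "f \<in> hom X (Dom X f) (Cod X f)" "g \<in> hom X (Cod X f) (Cod X g)"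
    "h \<in> hom X (Cod X g) (Cod X h)"
    using assms by (auto simp: hom_iff)
  then show ?thesis using category unfolding category_def by metis
qed

text \<open>Composites are normalised to right-nested form, where an equation
  \<open>g \<cdot> f = k\<close> no longer matches inside \<open>g \<cdot> f \<cdot> e\<close>. This
  is the instance of the equation under a trailing arrow.\<close>

lemma comp_extend:
  assumes "g \<cdot> f = k" "e \<in> Ar X" "f \<in> Ar X" "g \<in> Ar X" "Dom X f = Cod X e" "Dom X g = Cod X f"
  shows "g \<cdot> (f \<cdot> e) = k \<cdot> e"
  using assms by (simp add: comp_assoc[symmetric])

lemma inverse_arrows_iff:
  "inverse_arrows X u v \<longleftrightarrow> u \<in> Ar X \<and> v \<in> Ar X \<and> Dom X v = Cod X u \<and> Cod X v = Dom X u \<and>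
     v \<cdot> u = Ident X (Dom X u) \<and> u \<cdot> v = Ident X (Cod X u)"
  by (auto simp: inverse_arrows_def hom_iff)

lemma isomorphic_trans:
  assumes "isomorphic X a b" "isomorphic X b c"
  shows "isomorphic X a c"
proof -
  obtain u v u' v' where *: "u \<in> hom X a b" "inverse_arrows X u v"
      "u' \<in> hom X b c" "inverse_arrows X u' v'"
    using assms unfolding isomorphic_def by auto
  then have "u' \<cdot> u \<in> hom X a c" by (auto intro: comp_hom)
  moreover have "v \<cdot> v' \<cdot> u' \<cdot> u = Ident X a" "u' \<cdot> u \<cdot> v \<cdot> v' = Ident X c"
    using * by (auto simp: inverse_arrows_iff hom_iff comp_extend[of v' u'] comp_extend[of u v])
  then have "inverse_arrows X (u' \<cdot> u) (v \<cdot> v')"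
    using * by (auto simp: inverse_arrows_iff hom_iff comp_assoc)
  ultimately show ?thesis unfolding isomorphic_def by blast
qed

section \<open>Pullback squares: lifting, joint monicity, pasting\<close>

lemma is_pullbackD:
  assumes "is_pullback X f g p q"
  shows "f \<in> Ar X" "g \<in> Ar X" "p \<in> Ar X" "q \<in> Ar X" "Cod X g = Cod X f" "Dom X q = Dom X p"
    "Cod X p = Dom X f" "Cod X q = Dom X g" "f \<cdot> p = g \<cdot> q"
  using assms unfolding is_pullback_def by (auto simp: hom_iff)

lemma pullback_lift:
  assumes "is_pullback X f g p q" "p' \<in> hom X w (Dom X f)" "q' \<in> hom X w (Dom X g)"
    "f \<cdot> p' = g \<cdot> q'"
  obtains u where "u \<in> hom X w (Dom X p)" "p \<cdot> u = p'" "q \<cdot> u = q'"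
  using assms unfolding is_pullback_def by blast

lemma pullback_eqI:
  assumes pb: "is_pullback X f g p q" and "u \<in> hom X w (Dom X p)" "u' \<in> hom X w (Dom X p)"
    "p \<cdot> u = p \<cdot> u'" "q \<cdot> u = q \<cdot> u'"
  shows "u = u'"
proof -
  note d = is_pullbackD[OF pb]
  have "f \<cdot> p \<cdot> u = g \<cdot> q \<cdot> u"
    using d assms by (simp add: hom_iff comp_assoc[symmetric])
  moreover have "p \<cdot> u \<in> hom X w (Dom X f)" "q \<cdot> u \<in> hom X w (Dom X g)"
    using d assms by (simp_all add: hom_iff)
  ultimately have "\<exists>!z. z \<in> hom X w (Dom X p) \<and> p \<cdot> z = p \<cdot> u \<and> q \<cdot> z = q \<cdot> u"
    using pb unfolding is_pullback_def by blast
  then show ?thesis using assms by metis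
qed

lemma is_pullbackI:
  assumes "f \<in> Ar X" "g \<in> Ar X" "p \<in> Ar X" "q \<in> Ar X" "Cod X f = Cod X g" "Dom X q = Dom X p"
    "Cod X p = Dom X f" "Cod X q = Dom X g" "f \<cdot> p = g \<cdot> q"
    and "\<And>w p' q'. p' \<in> hom X w (Dom X f) \<Longrightarrow> q' \<in> hom X w (Dom X g) \<Longrightarrow> f \<cdot> p' = g \<cdot> q' \<Longrightarrow>
      \<exists>u. u \<in> hom X w (Dom X p) \<and> p \<cdot> u = p' \<and> q \<cdot> u = q'"
    and "\<And>w u u'. u \<in> hom X w (Dom X p) \<Longrightarrow> u' \<in> hom X w (Dom X p) \<Longrightarrow>
      p \<cdot> u = p \<cdot> u' \<Longrightarrow> q \<cdot> u = q \<cdot> u' \<Longrightarrow> u = u'"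
  shows "is_pullback X f g p q"
  unfolding is_pullback_def
proof (intro conjI allI impI)
  fix w p' q'
  assume *: "p' \<in> hom X w (Dom X f) \<and> q' \<in> hom X w (Dom X g) \<and> f \<cdot> p' = g \<cdot> q'"
  show "\<exists>!u. u \<in> hom X w (Dom X p) \<and> p \<cdot> u = p' \<and> q \<cdot> u = q'"
    using assms(10)[of p' w q'] assms(11)[of _ w] * by metis
qed (use assms in \<open>auto simp: hom_iff\<close>)

text \<open>The second square is a base change along the leg \<open>q\<close> of the first. With the
  naturality square of a cartesian \<open>h\<close> as first square, base change along its component
  at the source of an arrow becomes base change along the component at the target, with the second
  leg \<open>q'\<close> kept.\<close>

lemma pullback_pasting:
  assumes pb: "is_pullback X f g p q" and pb': "is_pullback X q d p' q'"
  shows "is_pullback X f (g \<cdot> d) (p \<cdot> p') q'"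
proof -
  note d = is_pullbackD[OF pb] is_pullbackD[OF pb']
  show ?thesis
  proof (rule is_pullbackI)
    have "f \<cdot> p \<cdot> p' = g \<cdot> q \<cdot> p'" using d by (simp add: comp_extend[OF d(9)] comp_assoc)
    then show "f \<cdot> p \<cdot> p' = (g \<cdot> d) \<cdot> q'" using d by (simp add: comp_assoc)
  next
    fix w a b
    assume a: "a \<in> hom X w (Dom X f)" and b: "b \<in> hom X w (Dom X (g \<cdot> d))"
      and ab: "f \<cdot> a = (g \<cdot> d) \<cdot> b"
    have db: "d \<cdot> b \<in> hom X w (Dom X g)" using b d by (simp add: hom_iff)
    have "f \<cdot> a = g \<cdot> d \<cdot> b" using ab b d by (simp add: hom_iff comp_assoc)
    then obtain u where u: "u \<in> hom X w (Dom X p)" "p \<cdot> u = a" "q \<cdot> u = d \<cdot> b"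
      using pullback_lift[OF pb a db] by metis
    obtain v where v: "v \<in> hom X w (Dom X p')" "p' \<cdot> v = u" "q' \<cdot> v = b"
      using pullback_lift[OF pb', of u w b] u b d by (auto simp: hom_iff)
    then have "(p \<cdot> p') \<cdot> v = a" using u d by (simp add: comp_assoc hom_iff)
    then show "\<exists>v. v \<in> hom X w (Dom X (p \<cdot> p')) \<and> (p \<cdot> p') \<cdot> v = a \<and> q' \<cdot> v = b"
      using v d by auto
  next
    fix w u u'
    assume u: "u \<in> hom X w (Dom X (p \<cdot> p'))" and u': "u' \<in> hom X w (Dom X (p \<cdot> p'))"
      and 1: "(p \<cdot> p') \<cdot> u = (p \<cdot> p') \<cdot> u'" and 2: "q' \<cdot> u = q' \<cdot> u'"
    have "d \<cdot> q' \<cdot> u = q \<cdot> p' \<cdot> u" "d \<cdot> q' \<cdot> u' = q \<cdot> p' \<cdot> u'"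
      using u u' d by (simp_all add: hom_iff comp_assoc[symmetric])
    then have 3: "q \<cdot> p' \<cdot> u = q \<cdot> p' \<cdot> u'" using 2 by simp
    have 4: "p \<cdot> p' \<cdot> u = p \<cdot> p' \<cdot> u'" using 1 u u' d by (simp add: hom_iff comp_assoc)
    have u2: "u \<in> hom X w (Dom X p')" "u' \<in> hom X w (Dom X p')" using u u' d by simp_all
    then have "p' \<cdot> u \<in> hom X w (Dom X p)" "p' \<cdot> u' \<in> hom X w (Dom X p)"
      using d by (simp_all add: hom_iff)
    then have "p' \<cdot> u = p' \<cdot> u'" using pullback_eqI[OF pb _ _ 4 3] by blast
    then show "u = u'" using pullback_eqI[OF pb' u2 _ 2] by blast
  qed (use d in simp_all)
qed

text \<open>The mediating arrow can only be \<open>p' \<cdot> a\<close>, since \<open>p\<close> is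
  invertible; its composite with \<open>q\<close> equals \<open>b\<close> because \<open>g\<close>
  can be cancelled from the commuting condition.\<close>

lemma commuting_square_of_isos_is_pullback:
  assumes "f \<in> Ar X" "g \<in> Ar X" "p \<in> Ar X" "q \<in> Ar X" "Cod X f = Cod X g" "Dom X q = Dom X p"
    "Cod X p = Dom X f" "Cod X q = Dom X g" "f \<cdot> p = g \<cdot> q"
    and g': "inverse_arrows X g g'" and p': "inverse_arrows X p p'"
  shows "is_pullback X f g p q"
proof (rule is_pullbackI)
  fix w a b
  assume a: "a \<in> hom X w (Dom X f)" and b: "b \<in> hom X w (Dom X g)" and ab: "f \<cdot> a = g \<cdot> b"
  have 1: "p \<cdot> p' \<cdot> a = a"
    using assms a by (simp add: comp_extend[of p p' "Ident X (Cod X p)"] inverse_arrows_iff hom_iff)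
  have "q \<cdot> p' \<cdot> a = g' \<cdot> g \<cdot> q \<cdot> p' \<cdot> a"
    using assms a by (simp add: comp_extend[of g' g "Ident X (Dom X g)"] inverse_arrows_iff hom_iff)
  also have "\<dots> = g' \<cdot> f \<cdot> p \<cdot> p' \<cdot> a"
    using assms a by (simp add: comp_extend[OF assms(9)] comp_assoc inverse_arrows_iff hom_iff)
  also have "\<dots> = b"
    using assms b unfolding 1 ab
    by (simp add: comp_extend[of g' g "Ident X (Dom X g)"] inverse_arrows_iff hom_iff)
  finally show "\<exists>u. u \<in> hom X w (Dom X p) \<and> p \<cdot> u = a \<and> q \<cdot> u = b"
    using 1 assms a by (intro exI[of _ "p' \<cdot> a"]) (simp add: inverse_arrows_iff hom_iff)
next
  fix w u u'
  assume u: "u \<in> hom X w (Dom X p)" "u' \<in> hom X w (Dom X p)" and "p \<cdot> u = p \<cdot> u'"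
  then have "p' \<cdot> p \<cdot> u = p' \<cdot> p \<cdot> u'" by simp
  then show "u = u'"
    using u assms
    by (simp add: comp_extend[of p' p "Ident X (Dom X p)"] inverse_arrows_iff hom_iff)
qed (use assms in simp_all)

section \<open>Slices and representing objects\<close>

lemma category_slice: "category (slice X a)"
proof -
  let ?S = "slice X a"
  have "\<forall>t\<in>Ar ?S. Dom ?S t \<in> Ob ?S \<and> Cod ?S t \<in> Ob ?S"
    by (auto simp: slice_def)
  moreover have "\<forall>f\<in>Ob ?S. Ident ?S f \<in> hom ?S f f"
    by (simp add: slice_hom_iff Ident_hom)
  moreover have "t' \<cdot>\<^bsub>?S\<^esub> t \<in> hom ?S f h" if "t \<in> hom ?S f g" "t' \<in> hom ?S g h" for f g h t t'
  proof -
    obtain u u' where u: "t = (f, g, u)" "u \<in> hom X (Dom X f) (Dom X g)" "g \<cdot> u = f"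
        "t' = (g, h, u')" "u' \<in> hom X (Dom X g) (Dom X h)" "h \<cdot> u' = g"
        and h: "f \<in> Ar X" "Cod X f = a" "h \<in> Ar X" "Cod X h = a"
      using \<open>t \<in> hom ?S f g\<close> \<open>t' \<in> hom ?S g h\<close> unfolding slice_hom_iff by blast
    have "h \<cdot> u' \<cdot> u = f"
      using comp_extend[OF u(6), of u] u h by (simp add: hom_iff)
    then show ?thesis using u(1,4) h comp_hom[OF u(2,5)] by (simp add: slice_hom_iff)
  qed
  moreover have "t \<cdot>\<^bsub>?S\<^esub> Ident ?S f = t \<and> Ident ?S g \<cdot>\<^bsub>?S\<^esub> t = t" if t: "t \<in> hom ?S f g" for f g t
  proof -
    obtain u where "t = (f, g, u)" "u \<in> hom X (Dom X f) (Dom X g)"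
      using t unfolding slice_hom_iff by blast
    then show ?thesis by (simp add: hom_iff)
  qed
  moreover have "t'' \<cdot>\<^bsub>?S\<^esub> (t' \<cdot>\<^bsub>?S\<^esub> t) = (t'' \<cdot>\<^bsub>?S\<^esub> t') \<cdot>\<^bsub>?S\<^esub> t"
    if t: "t \<in> hom ?S f g" "t' \<in> hom ?S g h" "t'' \<in> hom ?S h k" for f g h k t t' t''
  proof -
    obtain u u' u'' where "t = (f, g, u)" "u \<in> hom X (Dom X f) (Dom X g)"
        "t' = (g, h, u')" "u' \<in> hom X (Dom X g) (Dom X h)"
        "t'' = (h, k, u'')" "u'' \<in> hom X (Dom X h) (Dom X k)"
      using t unfolding slice_hom_iff by blast
    then show ?thesis by (simp add: comp_assoc hom_iff)
  qed
  ultimately show ?thesis unfolding category_def by blast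
qed

text \<open>An isomorphism of a slice amounts to four equations between composites, two for the
  triangles and two for the inverses, and a functor preserves each. This moves a comparison of two
  dependent products along precomposition.\<close>

lemma isomorphic_slice_image:
  assumes F: "is_functor X Y F" and iso: "isomorphic (slice X a) f g"
  shows "isomorphic (slice Y (fob F a)) (far F f) (far F g)"
proof -
  interpret S: cat "slice X a" by (rule cat.intro[OF category_slice])
  obtain s t where st: "s \<in> hom (slice X a) f g" "t \<in> hom (slice X a) g f"
      "t \<cdot>\<^bsub>slice X a\<^esub> s = Ident (slice X a) f" "s \<cdot>\<^bsub>slice X a\<^esub> t = Ident (slice X a) g"
    using iso unfolding isomorphic_def S.inverse_arrows_iff hom_iff by metis
  then obtain u v where s: "s = (f, g, u)" and t: "t = (g, f, v)"
      and h: "f \<in> hom X (Dom X f) a" "g \<in> hom X (Dom X g) a" "u \<in> hom X (Dom X f) (Dom X g)"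
      "v \<in> hom X (Dom X g) (Dom X f)" "g \<cdot> u = f" "f \<cdot> v = g"
    unfolding slice_hom_iff by (metis hom_iff)
  have *: "v \<cdot> u = Ident X (Dom X f)" "u \<cdot> v = Ident X (Dom X g)"
    using st s t by simp_all
  have F_hom: "\<And>a b f. f \<in> hom X a b \<Longrightarrow> far F f \<in> hom Y (fob F a) (fob F b)"
    and F_id: "\<And>a. a \<in> Ob X \<Longrightarrow> far F (Ident X a) = Ident Y (fob F a)"
    and F_comp: "\<And>a b c f g. f \<in> hom X a b \<Longrightarrow> g \<in> hom X b c \<Longrightarrow>
        far F (g \<cdot> f) = far F g \<cdot>\<^bsub>Y\<^esub> far F f"
    using F unfolding is_functor_def by blast+
  note F' = h(1-4)[THEN F_hom] F_comp[OF h(3,2)] F_comp[OF h(4,1)] F_comp[OF h(3,4)]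
    F_comp[OF h(4,3)]
  have "(far F f, far F g, far F u) \<in> hom (slice Y (fob F a)) (far F f) (far F g)"
    "(far F g, far F f, far F v) \<in> hom (slice Y (fob F a)) (far F g) (far F f)"
    using F' h(5,6) unfolding slice_hom_iff by (simp_all add: hom_iff)
  moreover have "far F v \<cdot>\<^bsub>Y\<^esub> far F u = Ident Y (Dom Y (far F f))"
     "far F u \<cdot>\<^bsub>Y\<^esub> far F v = Ident Y (Dom Y (far F g))"
    using F' h(1,2) * F_id by (simp_all add: hom_iff)
  ultimately show ?thesis
    unfolding isomorphic_def inverse_arrows_def by (force simp: hom_iff)
qed

text \<open>Yoneda: \<open>u\<close> and \<open>v\<close> are the arrows classifying the universal
  elements \<open>\<Phi> P (Ident X P)\<close> and \<open>\<Psi> Q (Ident X Q)\<close>. By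
  naturality each composite has the same image as an identity, and the bijections are
  injective.\<close>

lemma represents_unique:
  assumes P: "represents X Y L k P" and Q: "represents X Y L k Q"
  shows "isomorphic X P Q"
proof -
  obtain \<Phi> where \<Phi>: "\<And>D. D \<in> Ob X \<Longrightarrow> bij_betw (\<Phi> D) (hom X D P) (hom Y (fob L D) k)"
      and \<Phi>_nat: "\<And>D D' u s. u \<in> hom X D' D \<Longrightarrow> s \<in> hom X D P \<Longrightarrow>
        \<Phi> D' (s \<cdot> u) = \<Phi> D s \<cdot>\<^bsub>Y\<^esub> far L u"
    using P unfolding represents_def by blast
  obtain \<Psi> where \<Psi>: "\<And>D. D \<in> Ob X \<Longrightarrow> bij_betw (\<Psi> D) (hom X D Q) (hom Y (fob L D) k)"
      and \<Psi>_nat: "\<And>D D' u s. u \<in> hom X D' D \<Longrightarrow> s \<in> hom X D Q \<Longrightarrow>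
        \<Psi> D' (s \<cdot> u) = \<Psi> D s \<cdot>\<^bsub>Y\<^esub> far L u"
    using Q unfolding represents_def by blast
  have ob: "P \<in> Ob X" "Q \<in> Ob X" using P Q unfolding represents_def by auto
  have "\<Phi> P (Ident X P) \<in> hom Y (fob L P) k" "\<Psi> Q (Ident X Q) \<in> hom Y (fob L Q) k"
    using \<Phi>[OF ob(1)] \<Psi>[OF ob(2)] Ident_hom ob by (auto dest: bij_betwE)
  then obtain u v where u: "u \<in> hom X P Q" "\<Psi> P u = \<Phi> P (Ident X P)"
      and v: "v \<in> hom X Q P" "\<Phi> Q v = \<Psi> Q (Ident X Q)"
    using \<Phi>[OF ob(2)] \<Psi>[OF ob(1)] unfolding bij_betw_def by (metis imageE)
  have "\<Phi> P (v \<cdot> u) = \<Psi> Q (Ident X Q) \<cdot>\<^bsub>Y\<^esub> far L u" using \<Phi>_nat[OF u(1) v(1)] v by simp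
  also have "\<dots> = \<Phi> P (Ident X P)"
    using \<Psi>_nat[OF u(1) Ident_hom] u ob by (simp add: hom_iff)
  finally have vu: "v \<cdot> u = Ident X P"
    using bij_betw_imp_inj_on[OF \<Phi>[OF ob(1)]] comp_hom[OF u(1) v(1)] Ident_hom[OF ob(1)]
    by (auto dest: inj_onD)
  have "\<Psi> Q (u \<cdot> v) = \<Phi> P (Ident X P) \<cdot>\<^bsub>Y\<^esub> far L v" using \<Psi>_nat[OF v(1) u(1)] u by simp
  also have "\<dots> = \<Psi> Q (Ident X Q)"
    using \<Phi>_nat[OF v(1) Ident_hom] v ob by (simp add: hom_iff)
  finally have uv: "u \<cdot> v = Ident X Q"
    using bij_betw_imp_inj_on[OF \<Psi>[OF ob(2)]] comp_hom[OF v(1) u(1)] Ident_hom[OF ob(2)]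
    by (auto dest: inj_onD)
  show ?thesis
    using u v uv vu unfolding isomorphic_def inverse_arrows_iff by (auto simp: hom_iff)
qed

section \<open>The base change functor\<close>

definition pb_fst :: "'m \<Rightarrow> 'm \<Rightarrow> 'm" where
  "pb_fst f g = fst (chosen_pullback X f g)"

definition pb_snd :: "'m \<Rightarrow> 'm \<Rightarrow> 'm" where
  "pb_snd f g = snd (chosen_pullback X f g)"

lemma is_pullback_chosen:
  assumes "pullbacks_along X f" "g \<in> Ar X" "Cod X g = Cod X f"
  shows "is_pullback X f g (pb_fst f g) (pb_snd f g)"
proof -
  have "\<exists>z. case z of (p, q) \<Rightarrow> is_pullback X f g p q"
    using assms unfolding pullbacks_along_def by auto
  then show ?thesis
    unfolding pb_fst_def pb_snd_def chosen_pullback_def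
    by (metis (mono_tags, lifting) someI_ex case_prod_unfold)
qed

lemma fob_pullback_functor [simp]:
  "g \<in> Ar X \<Longrightarrow> Cod X g = Cod X f \<Longrightarrow> fob (pullback_functor X f) g = pb_fst f g"
  by (simp add: pullback_functor_def pb_fst_def)

text \<open>The definite description in \<open>pullback_functor\<close> is discharged here once;
  later arguments see only the equations that characterise the mediating arrow.\<close>

lemma far_pullback_functor:
  assumes f: "pullbacks_along X f" and u: "(g, g', u) \<in> hom (slice X (Cod X f)) g g'"
  obtains v where "far (pullback_functor X f) (g, g', u) = (pb_fst f g, pb_fst f g', v)"
    "v \<in> hom X (Dom X (pb_fst f g)) (Dom X (pb_fst f g'))"
    "pb_fst f g' \<cdot> v = pb_fst f g" "pb_snd f g' \<cdot> v = u \<cdot> pb_snd f g"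
proof -
  let ?Q = "\<lambda>v. v \<in> hom X (Dom X (pb_fst f g)) (Dom X (pb_fst f g')) \<and>
    pb_fst f g' \<cdot> v = pb_fst f g \<and> pb_snd f g' \<cdot> v = u \<cdot> pb_snd f g"
  have g: "g \<in> Ar X" "Cod X g = Cod X f" "g' \<in> Ar X" "Cod X g' = Cod X f"
      "u \<in> hom X (Dom X g) (Dom X g')" "g' \<cdot> u = g"
    using u by (simp_all add: slice_hom_iff)
  note pb = is_pullback_chosen[OF f g(1,2)] and pb' = is_pullback_chosen[OF f g(3,4)]
  note d = is_pullbackD[OF pb] is_pullbackD[OF pb']
  have 1: "f \<cdot> pb_fst f g = g' \<cdot> u \<cdot> pb_snd f g"
    using d g by (simp add: comp_extend[OF g(6)] hom_iff)
  have 2: "pb_fst f g \<in> hom X (Dom X (pb_fst f g)) (Dom X f)"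
      "u \<cdot> pb_snd f g \<in> hom X (Dom X (pb_fst f g)) (Dom X g')"
    using d g by (simp_all add: hom_iff)
  obtain v where v: "?Q v" using pullback_lift[OF pb' 2 1] by blast
  have "v' = v" if "?Q v'" for v'
    using that v pullback_eqI[OF pb'] by metis
  then have the: "(THE v. ?Q v) = v" using v by (blast intro: the_equality)
  have "(g, g', u) \<in> Ar (slice X (Cod X f))" using u by (simp add: hom_iff)
  then have "far (pullback_functor X f) (g, g', u) = (pb_fst f g, pb_fst f g', v)"
    using the by (simp add: pullback_functor_def pb_fst_def pb_snd_def case_prod_unfold Let_def)
  with v that show ?thesis by blast
qed

text \<open>Identities and composites of mediating arrows satisfy the equations of mediating arrows,
  so uniqueness of lifts gives functoriality. It is established from existence of pullbacks alone,
  as is needed along \<open>h\<close> in a functor category, where no adjunction is at hand.\<close>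

lemma is_functor_pullback_functor:
  assumes f: "pullbacks_along X f"
  shows "is_functor (slice X (Cod X f)) (slice X (Dom X f)) (pullback_functor X f)"
    (is "is_functor ?S ?T ?L")
proof -
  note pb = is_pullback_chosen[OF f]
  have ob: "fob ?L g \<in> Ob ?T" if "g \<in> Ob ?S" for g
    using that is_pullbackD[OF pb, of g] by simp
  have ar: "far ?L t \<in> hom ?T (fob ?L g) (fob ?L g')" if t: "t \<in> hom ?S g g'" for g g' t
  proof -
    obtain u where u: "t = (g, g', u)" "g \<in> Ar X" "g' \<in> Ar X" "Cod X g = Cod X f" "Cod X g' = Cod X f"
      using t unfolding slice_hom_iff by blast
    with t far_pullback_functor[OF f, of g g' u] obtain v where
      "far ?L t = (pb_fst f g, pb_fst f g', v)"
      "v \<in> hom X (Dom X (pb_fst f g)) (Dom X (pb_fst f g'))" "pb_fst f g' \<cdot> v = pb_fst f g"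
      by blast
    then show ?thesis
      using u is_pullbackD[OF pb, of g] is_pullbackD[OF pb, of g'] by (simp add: slice_hom_iff)
  qed
  have id: "far ?L (Ident ?S g) = Ident ?T (fob ?L g)" if g: "g \<in> Ob ?S" for g
  proof -
    note d = is_pullbackD[OF pb, of g]
    have "(g, g, Ident X (Dom X g)) \<in> hom ?S g g"
      using g Ident_hom by (simp add: slice_hom_iff)
    then obtain v where v: "far ?L (g, g, Ident X (Dom X g)) = (pb_fst f g, pb_fst f g, v)"
      "v \<in> hom X (Dom X (pb_fst f g)) (Dom X (pb_fst f g))"
      "pb_fst f g \<cdot> v = pb_fst f g" "pb_snd f g \<cdot> v = Ident X (Dom X g) \<cdot> pb_snd f g"
      using far_pullback_functor[OF f] by blast
    have "v = Ident X (Dom X (pb_fst f g))"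
      by (rule pullback_eqI[OF pb, of g]) (use g v d Ident_hom in \<open>simp_all add: hom_iff\<close>)
    then show ?thesis using v g by simp
  qed
  have comp: "far ?L (t' \<cdot>\<^bsub>?S\<^esub> t) = far ?L t' \<cdot>\<^bsub>?T\<^esub> far ?L t"
    if t: "t \<in> hom ?S a b" and t': "t' \<in> hom ?S b c" for a b c t t'
  proof -
    obtain u u' where u: "t = (a, b, u)" "t' = (b, c, u')" "a \<in> Ar X" "b \<in> Ar X" "c \<in> Ar X"
        "Cod X a = Cod X f" "Cod X b = Cod X f" "Cod X c = Cod X f"
        "u \<in> hom X (Dom X a) (Dom X b)" "u' \<in> hom X (Dom X b) (Dom X c)"
        "b \<cdot> u = a" "c \<cdot> u' = b"
      using t t' unfolding slice_hom_iff by blast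
    note d = is_pullbackD[OF pb, of a] is_pullbackD[OF pb, of b] is_pullbackD[OF pb, of c]
    obtain v where v: "far ?L t = (pb_fst f a, pb_fst f b, v)"
      "v \<in> hom X (Dom X (pb_fst f a)) (Dom X (pb_fst f b))"
      "pb_fst f b \<cdot> v = pb_fst f a" "pb_snd f b \<cdot> v = u \<cdot> pb_snd f a"
      using far_pullback_functor[OF f] t u by blast
    obtain v' where v': "far ?L t' = (pb_fst f b, pb_fst f c, v')"
      "v' \<in> hom X (Dom X (pb_fst f b)) (Dom X (pb_fst f c))"
      "pb_fst f c \<cdot> v' = pb_fst f b" "pb_snd f c \<cdot> v' = u' \<cdot> pb_snd f b"
      using far_pullback_functor[OF f] t' u by blast
    have tt: "t' \<cdot>\<^bsub>?S\<^esub> t \<in> hom ?S a c"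
      using t t' cat.comp_hom[OF cat.intro[OF category_slice]] by blast
    then obtain w where w: "far ?L (t' \<cdot>\<^bsub>?S\<^esub> t) = (pb_fst f a, pb_fst f c, w)"
      "w \<in> hom X (Dom X (pb_fst f a)) (Dom X (pb_fst f c))"
      "pb_fst f c \<cdot> w = pb_fst f a" "pb_snd f c \<cdot> w = (u' \<cdot> u) \<cdot> pb_snd f a"
      using far_pullback_functor[OF f, of a c "u' \<cdot> u"] u by auto
    have 1: "pb_fst f c \<cdot> v' \<cdot> v = pb_fst f a"
      using d u v v' by (simp add: hom_iff comp_extend[OF v'(3)])
    have 2: "pb_snd f c \<cdot> v' \<cdot> v = (u' \<cdot> u) \<cdot> pb_snd f a"
      using d u v v' by (simp add: hom_iff comp_extend[OF v'(4)] comp_assoc)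
    have "w = v' \<cdot> v"
      by (rule pullback_eqI[OF pb, of c]) (use d u v v' w 1 2 in \<open>simp_all add: hom_iff\<close>)
    then show ?thesis using v v' w by simp
  qed
  have ext: "fob ?L \<in> extensional (Ob ?S)" "far ?L \<in> extensional (Ar ?S)"
    by (simp_all add: pullback_functor_def)
  show ?thesis
    unfolding is_functor_def using ob ar id comp ext by blast
qed

section \<open>Transposition against arbitrary pullback squares\<close>

text \<open>
  \<open>P\<close> with the pullback \<open>(p, q)\<close> of \<open>f\<close> and \<open>P\<close>, and with \<open>e\<close> over the domain of \<open>f\<close>, is a candidate
  counit \<open>e : f\<^sup>* P \<rightarrow> k\<close>; \<open>u : d \<rightarrow> P\<close> transposes \<open>s\<close> if \<open>e \<circ> f\<^sup>* u = s\<close>, with \<open>f\<^sup>* d\<close> given by an arbitrary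
  pullback \<open>(p', q')\<close>. Freeing the universal property from the chosen pullbacks is what allows it to be
  applied to pasted squares below.
\<close>

definition transposes :: "'m \<Rightarrow> 'm \<Rightarrow> 'm \<Rightarrow> 'm \<Rightarrow> 'm \<Rightarrow> 'm \<Rightarrow> 'm \<Rightarrow> 'm \<Rightarrow> 'm \<Rightarrow> bool" where
  "transposes P p q e d p' q' s u \<longleftrightarrow> u \<in> hom X (Dom X d) (Dom X P) \<and> P \<cdot> u = d \<and>
     (\<exists>v\<in>hom X (Dom X p') (Dom X p). p \<cdot> v = p' \<and> q \<cdot> v = u \<cdot> q' \<and> e \<cdot> v = s)"

definition evaluation :: "'m \<Rightarrow> 'm \<Rightarrow> 'm \<Rightarrow> 'm \<Rightarrow> 'm \<Rightarrow> 'm \<Rightarrow> bool" where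
  "evaluation f k P p q e \<longleftrightarrow> is_pullback X f P p q \<and> k \<in> Ar X \<and> Cod X k = Dom X f \<and>
     e \<in> hom X (Dom X p) (Dom X k) \<and> k \<cdot> e = p \<and>
     (\<forall>d p' q' s. is_pullback X f d p' q' \<and> s \<in> hom X (Dom X p') (Dom X k) \<and> k \<cdot> s = p' \<longrightarrow>
        (\<exists>!u. transposes P p q e d p' q' s u))"

text \<open>The witness \<open>v\<close> is precomposed with \<open>j\<close>, while
  \<open>u\<close> stays the same. Asking only for an arrow \<open>j\<close> compatible with the
  legs lets one lemma serve both directions of an isomorphism of pullbacks.\<close>

lemma transposes_reindex:
  assumes pb: "is_pullback X f P p q" and pb1: "is_pullback X f d p1 q1"
    and e: "e \<in> hom X (Dom X p) c"
    and u: "transposes P p q e d p1 q1 s u"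
    and j: "j \<in> hom X (Dom X p2) (Dom X p1)" "p1 \<cdot> j = p2" "q1 \<cdot> j = q2"
  shows "transposes P p q e d p2 q2 (s \<cdot> j) u"
proof -
  note d = is_pullbackD[OF pb] is_pullbackD[OF pb1]
  obtain v where v: "v \<in> hom X (Dom X p1) (Dom X p)" "p \<cdot> v = p1" "q \<cdot> v = u \<cdot> q1" "e \<cdot> v = s"
    and u': "u \<in> hom X (Dom X d) (Dom X P)" "P \<cdot> u = d"
    using u unfolding transposes_def by blast
  have 1: "v \<cdot> j \<in> hom X (Dom X p2) (Dom X p)" using v j comp_hom by blast
  have 2: "p \<cdot> v \<cdot> j = p2" "e \<cdot> v \<cdot> j = s \<cdot> j"
    using d v j e by (simp_all add: hom_iff comp_extend[OF v(2)] comp_extend[OF v(4)])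
  have "q \<cdot> v \<cdot> j = u \<cdot> q2"
    using d v j u' by (simp add: hom_iff comp_extend[OF v(3)] comp_assoc)
  then show ?thesis unfolding transposes_def using u' 1 2 by blast
qed

lemma pullbacks_isomorphic:
  assumes pb: "is_pullback X f g p q" and pb': "is_pullback X f g p' q'"
  obtains i j where "i \<in> hom X (Dom X p) (Dom X p')" "p' \<cdot> i = p" "q' \<cdot> i = q"
    "j \<in> hom X (Dom X p') (Dom X p)" "p \<cdot> j = p'" "q \<cdot> j = q'"
    "j \<cdot> i = Ident X (Dom X p)" "i \<cdot> j = Ident X (Dom X p')"
proof -
  note d = is_pullbackD[OF pb] is_pullbackD[OF pb']
  obtain i where i: "i \<in> hom X (Dom X p) (Dom X p')" "p' \<cdot> i = p" "q' \<cdot> i = q"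
    using pullback_lift[OF pb', of p "Dom X p" q] d unfolding hom_iff by metis
  obtain j where j: "j \<in> hom X (Dom X p') (Dom X p)" "p \<cdot> j = p'" "q \<cdot> j = q'"
    using pullback_lift[OF pb, of p' "Dom X p'" q'] d unfolding hom_iff by metis
  have "j \<cdot> i = Ident X (Dom X p)"
    by (rule pullback_eqI[OF pb, of _ "Dom X p"]) (use d i j in \<open>simp_all add: hom_iff comp_extend[OF j(2)] comp_extend[OF j(3)]\<close>)
  moreover have "i \<cdot> j = Ident X (Dom X p')"
    by (rule pullback_eqI[OF pb', of _ "Dom X p'"]) (use d i j in \<open>simp_all add: hom_iff comp_extend[OF i(2)] comp_extend[OF i(3)]\<close>)
  ultimately show ?thesis using i j that by blast
qed

text \<open>It suffices to check the universal property on one pullback of \<open>f\<close> and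
  \<open>d\<close>: precomposition with the comparison isomorphism matches the maps \<open>s\<close>
  over the two vertices and leaves the set of transposes unchanged. It is applied once to reach
  chosen pullbacks, and once to reach objectwise ones.\<close>

lemma ex1_transposes_reindex:
  assumes pb: "is_pullback X f P p q" and pb1: "is_pullback X f d p1 q1"
    and pb2: "is_pullback X f d p2 q2" and e: "e \<in> hom X (Dom X p) (Dom X k)"
    and k: "k \<in> Ar X" "Cod X k = Dom X f"
    and univ: "\<And>s. s \<in> hom X (Dom X p1) (Dom X k) \<Longrightarrow> k \<cdot> s = p1 \<Longrightarrow>
      \<exists>!u. transposes P p q e d p1 q1 s u"
    and s: "s \<in> hom X (Dom X p2) (Dom X k)" "k \<cdot> s = p2"
  shows "\<exists>!u. transposes P p q e d p2 q2 s u"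
proof -
  note d = is_pullbackD[OF pb] is_pullbackD[OF pb1] is_pullbackD[OF pb2]
  obtain i j where ij: "i \<in> hom X (Dom X p1) (Dom X p2)" "p2 \<cdot> i = p1" "q2 \<cdot> i = q1"
    "j \<in> hom X (Dom X p2) (Dom X p1)" "p1 \<cdot> j = p2" "q1 \<cdot> j = q2"
    "j \<cdot> i = Ident X (Dom X p1)" "i \<cdot> j = Ident X (Dom X p2)"
    using pullbacks_isomorphic[OF pb1 pb2] by metis
  have sij: "(s \<cdot> i) \<cdot> j = s" using ij s by (simp add: hom_iff comp_assoc)
  have "k \<cdot> s \<cdot> i = p1" using ij s k by (simp add: hom_iff comp_extend[OF s(2)])
  then have ex1: "\<exists>!u. transposes P p q e d p1 q1 (s \<cdot> i) u"
    using univ[of "s \<cdot> i"] ij s comp_hom by blast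
  have "transposes P p q e d p1 q1 (s \<cdot> i) u \<longleftrightarrow> transposes P p q e d p2 q2 s u" for u
    using transposes_reindex[OF pb pb1 e, of "s \<cdot> i" u j p2 q2]
      transposes_reindex[OF pb pb2 e, of s u i p1 q1] ij sij by metis
  then show ?thesis using ex1 by simp
qed

text \<open>The representation sends \<open>t\<close> to its base change followed by the counit.
  Naturality is then functoriality of base change together with associativity, and bijectivity is
  the universal property at the chosen pullbacks.\<close>

lemma dependent_product_of_evaluation:
  assumes f: "pullbacks_along X f" and ev: "evaluation f k P p q e"
  shows "dependent_product X f k P"
proof -
  let ?S = "slice X (Cod X f)" and ?T = "slice X (Dom X f)" and ?L = "pullback_functor X f"
  interpret T: cat ?T by (rule cat.intro[OF category_slice])
  note L = is_functor_pullback_functor[OF f]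
  have L_hom: "\<And>a b t. t \<in> hom ?S a b \<Longrightarrow> far ?L t \<in> hom ?T (fob ?L a) (fob ?L b)"
    and L_comp: "\<And>a b c t t'. t \<in> hom ?S a b \<Longrightarrow> t' \<in> hom ?S b c \<Longrightarrow>
      far ?L (t' \<cdot>\<^bsub>?S\<^esub> t) = far ?L t' \<cdot>\<^bsub>?T\<^esub> far ?L t"
    using L unfolding is_functor_def by blast+
  have pb: "is_pullback X f P p q" and k: "k \<in> Ar X" "Cod X k = Dom X f"
    and e: "e \<in> hom X (Dom X p) (Dom X k)" "k \<cdot> e = p"
    and univ: "\<And>d p' q' s. is_pullback X f d p' q' \<Longrightarrow> s \<in> hom X (Dom X p') (Dom X k) \<Longrightarrow>
      k \<cdot> s = p' \<Longrightarrow> \<exists>!u. transposes P p q e d p' q' s u"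
    using ev unfolding evaluation_def by blast+
  note d = is_pullbackD[OF pb]
  note pbP = is_pullback_chosen[OF f d(2,5)]
  note dP = is_pullbackD[OF pbP]
  obtain i j where ij: "i \<in> hom X (Dom X (pb_fst f P)) (Dom X p)" "p \<cdot> i = pb_fst f P"
    "q \<cdot> i = pb_snd f P" "j \<in> hom X (Dom X p) (Dom X (pb_fst f P))" "pb_fst f P \<cdot> j = p"
    "pb_snd f P \<cdot> j = q"
    "j \<cdot> i = Ident X (Dom X (pb_fst f P))" "i \<cdot> j = Ident X (Dom X p)"
    using pullbacks_isomorphic[OF pbP pb] by metis
  \<comment> \<open>The given counit lives over the pullback \<open>(p, q)\<close>, while
    \<open>pullback_functor\<close> uses the chosen one; the isomorphism \<open>i\<close> between
    them corrects the domain.\<close>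
  define \<epsilon> where "\<epsilon> = (pb_fst f P, k, e \<cdot> i)"
  have ki: "k \<cdot> e \<cdot> i = pb_fst f P"
    using e k ij by (simp add: hom_iff comp_extend[OF e(2)])
  have \<epsilon>: "\<epsilon> \<in> hom ?T (fob ?L P) k"
    using e k ij d dP ki unfolding \<epsilon>_def slice_hom_iff by (simp add: hom_iff)
  define \<Phi> where "\<Phi> = (\<lambda>D :: 'm. \<lambda>t. \<epsilon> \<cdot>\<^bsub>?T\<^esub> far ?L t)"
  have \<Phi>_iff: "\<Phi> D (D, P, u) = (pb_fst f D, k, s) \<longleftrightarrow>
      transposes P p q e D (pb_fst f D) (pb_snd f D) s u"
    if u: "(D, P, u) \<in> hom ?S D P" for D u s
  proof -
    have D: "D \<in> Ar X" "Cod X D = Cod X f" "u \<in> hom X (Dom X D) (Dom X P)" "P \<cdot> u = D"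
      using u by (simp_all add: slice_hom_iff)
    note dD = is_pullbackD[OF is_pullback_chosen[OF f D(1,2)]]
    obtain v where v: "far ?L (D, P, u) = (pb_fst f D, pb_fst f P, v)"
      "v \<in> hom X (Dom X (pb_fst f D)) (Dom X (pb_fst f P))"
      "pb_fst f P \<cdot> v = pb_fst f D" "pb_snd f P \<cdot> v = u \<cdot> pb_snd f D"
      using far_pullback_functor[OF f u] by blast
    have iv: "i \<cdot> v \<in> hom X (Dom X (pb_fst f D)) (Dom X p)" "p \<cdot> i \<cdot> v = pb_fst f D"
        "q \<cdot> i \<cdot> v = u \<cdot> pb_snd f D"
      using ij v d by (simp_all add: hom_iff comp_extend[OF ij(2)] comp_extend[OF ij(3)])
    have "\<Phi> D (D, P, u) = (pb_fst f D, k, e \<cdot> i \<cdot> v)"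
      using v ij e by (simp add: \<Phi>_def \<epsilon>_def hom_iff comp_assoc)
    \<comment> \<open>The existential in \<open>transposes\<close> admits only the witness
      \<open>i \<cdot> v\<close>, since \<open>p\<close> and \<open>q\<close> are jointly
      monic.\<close>
    moreover have "transposes P p q e D (pb_fst f D) (pb_snd f D) s u \<longleftrightarrow> e \<cdot> i \<cdot> v = s"
      unfolding transposes_def using D iv pullback_eqI[OF pb iv(1)] by metis
    ultimately show ?thesis by simp
  qed
  have "bij_betw (\<Phi> D) (hom ?S D P) (hom ?T (fob ?L D) k)" if D: "D \<in> Ob ?S" for D
  proof -
    have D': "D \<in> Ar X" "Cod X D = Cod X f" using D by auto
    note pbD = is_pullback_chosen[OF f D']
    have "\<exists>!t. t \<in> hom ?S D P \<and> \<Phi> D t = r" if r: "r \<in> hom ?T (fob ?L D) k" for r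
    proof -
      obtain s where s: "r = (pb_fst f D, k, s)" "s \<in> hom X (Dom X (pb_fst f D)) (Dom X k)"
          "k \<cdot> s = pb_fst f D"
        using r D' unfolding slice_hom_iff fob_pullback_functor[OF D'] by blast
      obtain u where u: "transposes P p q e D (pb_fst f D) (pb_snd f D) s u"
          "\<And>u'. transposes P p q e D (pb_fst f D) (pb_snd f D) s u' \<Longrightarrow> u' = u"
        using univ[OF pbD s(2,3)] by blast
      have "(D, P, u) \<in> hom ?S D P"
        using u(1) D' d unfolding transposes_def by (simp add: slice_hom_iff)
      moreover have "t = (D, P, u)" if "t \<in> hom ?S D P" "\<Phi> D t = r" for t
        using that u(2) \<Phi>_iff s(1) unfolding slice_hom_iff by metis
      ultimately show ?thesis using \<Phi>_iff u(1) s(1) by blast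
    qed
    moreover have "\<Phi> D t \<in> hom ?T (fob ?L D) k" if "t \<in> hom ?S D P" for t
      unfolding \<Phi>_def using T.comp_hom[OF L_hom[OF that] \<epsilon>] .
    ultimately show ?thesis by (intro bij_betwI') metis+
  qed
  moreover have "\<Phi> D' (s \<cdot>\<^bsub>?S\<^esub> u) = \<Phi> D s \<cdot>\<^bsub>?T\<^esub> far ?L u"
    if u: "u \<in> hom ?S D' D" and s: "s \<in> hom ?S D P" for D D' u s
    using L_comp[OF u s] L_hom[OF u] L_hom[OF s] \<epsilon>
    by (simp add: \<Phi>_def T.comp_assoc hom_iff)
  moreover have "P \<in> Ob ?S" "k \<in> Ob ?T" using d k by simp_all
  ultimately show ?thesis
    unfolding dependent_product_def represents_def using f by blast
qed

text \<open>By Yoneda the representation is determined by the image of the identity of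
  \<open>P\<close>, which serves as counit. Bijectivity yields the universal property at chosen
  pullbacks, and reindexing spreads it to all.\<close>

lemma evaluation_of_dependent_product:
  assumes dp: "dependent_product X f k P"
  obtains p q e where "evaluation f k P p q e"
proof -
  let ?S = "slice X (Cod X f)" and ?T = "slice X (Dom X f)" and ?L = "pullback_functor X f"
  interpret S: cat ?S by (rule cat.intro[OF category_slice])
  interpret T: cat ?T by (rule cat.intro[OF category_slice])
  have f: "pullbacks_along X f" and P: "P \<in> Ar X" "Cod X P = Cod X f"
    and k: "k \<in> Ar X" "Cod X k = Dom X f"
    using dp unfolding dependent_product_def represents_def by auto
  obtain \<Phi> where \<Phi>: "\<And>D. D \<in> Ob ?S \<Longrightarrow> bij_betw (\<Phi> D) (hom ?S D P) (hom ?T (fob ?L D) k)"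
    and \<Phi>_nat: "\<And>D D' u s. u \<in> hom ?S D' D \<Longrightarrow> s \<in> hom ?S D P \<Longrightarrow>
             \<Phi> D' (s \<cdot>\<^bsub>?S\<^esub> u) = \<Phi> D s \<cdot>\<^bsub>?T\<^esub> far ?L u"
    using dp unfolding dependent_product_def represents_def by blast
  note pb = is_pullback_chosen[OF f P]
  note d = is_pullbackD[OF pb]
  have idP: "Ident ?S P \<in> hom ?S P P" using P by (intro S.Ident_hom) simp
  then have "\<Phi> P (Ident ?S P) \<in> hom ?T (fob ?L P) k"
    using \<Phi>[of P] P bij_betwE by fastforce
  then obtain e where e: "\<Phi> P (Ident ?S P) = (pb_fst f P, k, e)"
      "e \<in> hom X (Dom X (pb_fst f P)) (Dom X k)" "k \<cdot> e = pb_fst f P"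
    unfolding slice_hom_iff fob_pullback_functor[OF P] by blast
  have \<Phi>_iff: "\<Phi> D (D, P, u) = (pb_fst f D, k, s) \<longleftrightarrow>
      transposes P (pb_fst f P) (pb_snd f P) e D (pb_fst f D) (pb_snd f D) s u"
    if u: "(D, P, u) \<in> hom ?S D P" for D u s
  proof -
    have D: "D \<in> Ar X" "Cod X D = Cod X f" "u \<in> hom X (Dom X D) (Dom X P)" "P \<cdot> u = D"
      using u by (simp_all add: slice_hom_iff)
    obtain v where v: "far ?L (D, P, u) = (pb_fst f D, pb_fst f P, v)"
      "v \<in> hom X (Dom X (pb_fst f D)) (Dom X (pb_fst f P))"
      "pb_fst f P \<cdot> v = pb_fst f D" "pb_snd f P \<cdot> v = u \<cdot> pb_snd f D"
      using far_pullback_functor[OF f u] by blast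
    have "\<Phi> D (D, P, u) = (pb_fst f D, k, e \<cdot> v)"
      using \<Phi>_nat[OF u idP] v e D P by (simp add: hom_iff)
    moreover have "transposes P (pb_fst f P) (pb_snd f P) e D (pb_fst f D) (pb_snd f D) s u \<longleftrightarrow>
        e \<cdot> v = s"
      unfolding transposes_def using D v pullback_eqI[OF pb v(2)] by metis
    ultimately show ?thesis by simp
  qed
  have "\<exists>!u. transposes P (pb_fst f P) (pb_snd f P) e D p' q' s u"
    if pb': "is_pullback X f D p' q'" and s: "s \<in> hom X (Dom X p') (Dom X k)" "k \<cdot> s = p'"
    for D p' q' s
  proof (rule ex1_transposes_reindex[OF pb _ pb' e(2) k _ s])
    have D: "D \<in> Ar X" "Cod X D = Cod X f" using is_pullbackD[OF pb'] by auto
    show pbD: "is_pullback X f D (pb_fst f D) (pb_snd f D)" by (rule is_pullback_chosen[OF f D])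
    fix s
    assume s: "s \<in> hom X (Dom X (pb_fst f D)) (Dom X k)" "k \<cdot> s = pb_fst f D"
    then have "(pb_fst f D, k, s) \<in> hom ?T (fob ?L D) k"
      using D k is_pullbackD[OF pbD] by (simp add: slice_hom_iff)
    then have "(pb_fst f D, k, s) \<in> \<Phi> D ` hom ?S D P"
      using \<Phi>[of D] D by (simp add: bij_betw_def)
    then obtain t where t: "t \<in> hom ?S D P" "\<Phi> D t = (pb_fst f D, k, s)" by (metis imageE)
    then obtain u where "t = (D, P, u)" unfolding slice_hom_iff by blast
    with t have u: "(D, P, u) \<in> hom ?S D P" "\<Phi> D (D, P, u) = (pb_fst f D, k, s)" by simp_all
    have "u' = u"
      if u': "transposes P (pb_fst f P) (pb_snd f P) e D (pb_fst f D) (pb_snd f D) s u'" for u'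
    proof -
      have m: "(D, P, u') \<in> hom ?S D P"
        using u' D P unfolding transposes_def by (simp add: slice_hom_iff)
      then have "\<Phi> D (D, P, u') = \<Phi> D (D, P, u)" using \<Phi>_iff u' u(2) by simp
      then show ?thesis
        using inj_onD[OF bij_betw_imp_inj_on[OF \<Phi>], of D "(D, P, u')" "(D, P, u)"] m u(1) D by simp
    qed
    then show "\<exists>!u. transposes P (pb_fst f P) (pb_snd f P) e D (pb_fst f D) (pb_snd f D) s u"
      using \<Phi>_iff[OF u(1)] u(2) by blast
  qed
  then have "evaluation f k P (pb_fst f P) (pb_snd f P) e"
    unfolding evaluation_def using pb k e by blast
  then show ?thesis by (rule that)
qed

text \<open>Fixing \<open>k\<close> in the adjunction and inverting the transposition bijections
  shows that \<open>fob R k\<close> represents the required functor.\<close>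

lemma dependent_product_of_powerful:
  assumes "powerful X f" and k: "k \<in> Ar X" "Cod X k = Dom X f"
  obtains P where "dependent_product X f k P"
proof -
  let ?S = "slice X (Cod X f)" and ?T = "slice X (Dom X f)" and ?L = "pullback_functor X f"
  interpret S: cat ?S by (rule cat.intro[OF category_slice])
  interpret T: cat ?T by (rule cat.intro[OF category_slice])
  obtain R \<Phi> where f: "pullbacks_along X f"
      and L: "is_functor ?S ?T ?L" and R: "is_functor ?T ?S R"
      and \<Phi>: "\<And>x y. x \<in> Ob ?S \<Longrightarrow> y \<in> Ob ?T \<Longrightarrow>
        bij_betw (\<Phi> x y) (hom ?T (fob ?L x) y) (hom ?S x (fob R y))"
      and \<Phi>_nat: "\<And>x x' y y' u v s. u \<in> hom ?S x' x \<Longrightarrow> v \<in> hom ?T y y' \<Longrightarrow>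
        s \<in> hom ?T (fob ?L x) y \<Longrightarrow>
        \<Phi> x' y' (v \<cdot>\<^bsub>?T\<^esub> s \<cdot>\<^bsub>?T\<^esub> far ?L u) = far R v \<cdot>\<^bsub>?S\<^esub> \<Phi> x y s \<cdot>\<^bsub>?S\<^esub> u"
    using assms unfolding powerful_def adjoint_functors_def by blast
  have kT: "k \<in> Ob ?T" using k by simp
  have RT: "fob R k \<in> Ob ?S" and Rid: "far R (Ident ?T k) = Ident ?S (fob R k)"
    using R kT unfolding is_functor_def by blast+
  have L_hom: "\<And>a b t. t \<in> hom ?S a b \<Longrightarrow> far ?L t \<in> hom ?T (fob ?L a) (fob ?L b)"
    using L unfolding is_functor_def by blast
  define \<Psi> where "\<Psi> = (\<lambda>D. inv_into (hom ?T (fob ?L D) k) (\<Phi> D k))"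
  have bij: "bij_betw (\<Psi> D) (hom ?S D (fob R k)) (hom ?T (fob ?L D) k)" if "D \<in> Ob ?S" for D
    unfolding \<Psi>_def using bij_betw_inv_into[OF \<Phi>[OF that kT]] .
  moreover have "\<Psi> D' (s \<cdot>\<^bsub>?S\<^esub> u) = \<Psi> D s \<cdot>\<^bsub>?T\<^esub> far ?L u"
    if u: "u \<in> hom ?S D' D" and s: "s \<in> hom ?S D (fob R k)" for D D' u s
  proof -
    have ob: "D \<in> Ob ?S" "D' \<in> Ob ?S" using S.hom_Ob[OF u] by auto
    have \<Psi>s: "\<Psi> D s \<in> hom ?T (fob ?L D) k" "\<Phi> D k (\<Psi> D s) = s"
      using bij_betwE[OF bij[OF ob(1)]] s bij_betw_inv_into_right[OF \<Phi>[OF ob(1) kT] s]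
      by (simp_all add: \<Psi>_def)
    have m: "\<Psi> D s \<cdot>\<^bsub>?T\<^esub> far ?L u \<in> hom ?T (fob ?L D') k"
      using T.comp_hom[OF L_hom[OF u] \<Psi>s(1)] .
    have su: "s \<cdot>\<^bsub>?S\<^esub> u \<in> hom ?S D' (fob R k)" using S.comp_hom[OF u s] .
    \<comment> \<open>The adjunction is natural in both variables at once. An identity of
      \<open>k\<close> is inserted to fill the second slot, and \<open>far R\<close> turns it into
      an identity again.\<close>
    have "\<Phi> D' k (\<Psi> D s \<cdot>\<^bsub>?T\<^esub> far ?L u) =
        \<Phi> D' k (Ident ?T k \<cdot>\<^bsub>?T\<^esub> \<Psi> D s \<cdot>\<^bsub>?T\<^esub> far ?L u)"
      using m T.comp_Ident(2)[of "\<Psi> D s \<cdot>\<^bsub>?T\<^esub> far ?L u" k] by (simp only: hom_iff)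
    also have "\<dots> = Ident ?S (fob R k) \<cdot>\<^bsub>?S\<^esub> s \<cdot>\<^bsub>?S\<^esub> u"
      using \<Phi>_nat[OF u T.Ident_hom[OF kT] \<Psi>s(1)] \<Psi>s(2) Rid by simp
    also have "\<dots> = s \<cdot>\<^bsub>?S\<^esub> u" using su S.comp_Ident(2)[of "s \<cdot>\<^bsub>?S\<^esub> u" "fob R k"] by (simp only: hom_iff)
    finally have "\<Phi> D' k (\<Psi> D s \<cdot>\<^bsub>?T\<^esub> far ?L u) = s \<cdot>\<^bsub>?S\<^esub> u" .
    then show ?thesis
      using bij_betw_inv_into_left[OF \<Phi>[OF ob(2) kT] m] unfolding \<Psi>_def by simp
  qed
  ultimately have "dependent_product X f k (fob R k)"
    unfolding dependent_product_def represents_def using f kT RT by blast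
  then show ?thesis by (rule that)
qed

lemma dependent_product_unique:
  assumes "dependent_product X f k P" "dependent_product X f k Q"
  shows "isomorphic (slice X (Cod X f)) P Q"
  by (rule cat.represents_unique[OF cat.intro[OF category_slice]
        conjunct2[OF assms(1)[unfolded dependent_product_def]]
        conjunct2[OF assms(2)[unfolded dependent_product_def]]])

end

section \<open>The localisation is a groupoid\<close>

text \<open>The empty zigzag carries the condition that its endpoint is an object. In the base case
  this condition has to be recovered from \<open>q\<close>, which is where \<open>category X\<close>
  enters.\<close>

lemma zigzag_append:
  "zigzag X x (p @ q) y \<longleftrightarrow> (\<exists>z. zigzag X x p z \<and> zigzag X z q y)" if "category X"
proof (induction p arbitrary: x)
  case Nil
  have "zigzag X x q y \<Longrightarrow> x \<in> Ob X"
    using that unfolding category_def by (cases q) (auto split: step.splits)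
  then show ?case by auto
next
  case (Cons s p)
  then show ?case by (cases s) auto
qed

text \<open>Splitting off an empty zigzag at either end exposes the object condition attached to
  \<open>[]\<close>.\<close>

lemma zigzag_Ob:
  assumes "category X" "zigzag X x p y"
  shows "x \<in> Ob X" "y \<in> Ob X"
  using zigzag_append[OF assms(1), of x "[]" p y] zigzag_append[OF assms(1), of x p "[]" y] assms(2)
  by auto

lemma zz_rewrite_append:
  assumes X: "category X" and "zz_rewrite X x y p q" "zigzag X w u x" "zigzag X y v z"
  shows "zz_rewrite X w z (u @ p @ v) (u @ q @ v)"
proof -
  obtain a l r b where "zz_basic X l r" "p = a @ l @ b" "q = a @ r @ b"
      "zigzag X x p y" "zigzag X x q y"
    using assms(2) unfolding zz_rewrite_def by blast
  then have "u @ p @ v = (u @ a) @ l @ (b @ v)" "u @ q @ v = (u @ a) @ r @ (b @ v)"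
      "zigzag X w (u @ p @ v) z" "zigzag X w (u @ q @ v) z"
    using assms by (auto simp: zigzag_append[OF X])
  then show ?thesis using \<open>zz_basic X l r\<close> unfolding zz_rewrite_def by blast
qed

text \<open>Rewriting takes place inside a context, so a context can be enlarged on both sides; this
  makes the generated equivalence a congruence for concatenation.\<close>

lemma equivclp_zz_rewrite_append:
  assumes X: "category X" and eq: "equivclp (zz_rewrite X x y) p q"
    and u: "zigzag X w u x" and v: "zigzag X y v z"
  shows "equivclp (zz_rewrite X w z) (u @ p @ v) (u @ q @ v)"
  using eq
proof (induction rule: equivclp_induct)
  case (step q r)
  then have "zz_rewrite X w z (u @ q @ v) (u @ r @ v) \<or> zz_rewrite X w z (u @ r @ v) (u @ q @ v)"
    using zz_rewrite_append[OF X _ u v] by blast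
  then show ?case using step.IH by (meson equivclp_into_equivclp)
qed simp

lemma zz_class_eq_iff:
  "zz_class X x p y = zz_class X x q y \<longleftrightarrow> equivclp (zz_rewrite X x y) p q"
  unfolding zz_class_def
  by (metis (mono_tags) equivclp_refl equivclp_sym equivclp_trans mem_Collect_eq Collect_cong)

lemma zz_class_eqI:
  assumes "zz_basic X l r" "zigzag X x (u @ l @ v) y" "zigzag X x (u @ r @ v) y"
  shows "zz_class X x (u @ l @ v) y = zz_class X x (u @ r @ v) y"
  unfolding zz_class_eq_iff
  using assms by (intro r_into_equivclp) (auto simp: zz_rewrite_def)

text \<open>Composition is defined as a union over all pairs of representatives. By the congruence
  property all of these contribute the same class, so the union collapses. The inner endpoints
  \<open>y'\<close> and \<open>y''\<close> are free because \<open>Comp\<close> does not inspect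
  them.\<close>

lemma localisation_comp:
  assumes X: "category X" and p: "zigzag X x p y" and q: "zigzag X y q z"
  shows "(y', zz_class X y q z, z) \<cdot>\<^bsub>localisation X\<^esub> (x, zz_class X x p y, y'') =
    (x, zz_class X x (p @ q) z, z)"
proof -
  have "zz_class X x (p' @ q') z = zz_class X x (p @ q) z"
    if "p' \<in> zz_class X x p y" "q' \<in> zz_class X y q z" for p' q'
  proof -
    have p': "equivclp (zz_rewrite X x y) p p'" and q': "equivclp (zz_rewrite X y z) q q'"
      using that by (auto simp: zz_class_def)
    \<comment> \<open>Both sides of a rewrite step are zigzags with the same endpoints, so this
      property of \<open>p\<close> propagates through its class.\<close>
    have "zigzag X x p' y"
      using p' p by (induction rule: equivclp_induct) (auto simp: zz_rewrite_def)
    then have "equivclp (zz_rewrite X x z) (p' @ q) (p' @ q')"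
      using equivclp_zz_rewrite_append[OF X q', of x p' "[]" z] zigzag_Ob[OF X q] by simp
    moreover have "equivclp (zz_rewrite X x z) (p @ q) (p' @ q)"
      using equivclp_zz_rewrite_append[OF X p' _ q, of x "[]"] zigzag_Ob[OF X p] by simp
    ultimately show ?thesis
      unfolding zz_class_eq_iff by (meson equivclp_sym equivclp_trans)
  qed
  moreover have "p \<in> zz_class X x p y" "q \<in> zz_class X y q z" by (auto simp: zz_class_def)
  ultimately have "(\<Union>p'\<in>zz_class X x p y. \<Union>q'\<in>zz_class X y q z. zz_class X x (p' @ q') z) =
      zz_class X x (p @ q) z"
    by blast
  then show ?thesis by (simp add: localisation_def)
qed

lemma localisation_hom_iff:
  "t \<in> hom (localisation X) x y \<longleftrightarrow> (\<exists>p. zigzag X x p y \<and> t = (x, zz_class X x p y, y))"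
  by (auto simp: hom_def localisation_def)

lemma localisation_simps [simp]:
  "Ob (localisation X) = Ob X"
  "Ident (localisation X) x = (x, zz_class X x [] x, x)"
  by (simp_all add: localisation_def)

lemma category_localisation:
  assumes X: "category X"
  shows "category (localisation X)"
proof -
  let ?G = "localisation X"
  have "\<forall>t\<in>Ar ?G. Dom ?G t \<in> Ob ?G \<and> Cod ?G t \<in> Ob ?G"
    using zigzag_Ob[OF X] by (auto simp: localisation_def)
  moreover have "\<forall>x\<in>Ob ?G. Ident ?G x \<in> hom ?G x x"
    unfolding localisation_hom_iff by (auto intro: exI[of _ "[]"])
  moreover have "t' \<cdot>\<^bsub>?G\<^esub> t \<in> hom ?G x z" if "t \<in> hom ?G x y" "t' \<in> hom ?G y z" for x y z t t'
    using that localisation_comp[OF X] zigzag_append[OF X]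
    unfolding localisation_hom_iff by fastforce
  moreover have "t \<cdot>\<^bsub>?G\<^esub> Ident ?G x = t \<and> Ident ?G y \<cdot>\<^bsub>?G\<^esub> t = t" if t: "t \<in> hom ?G x y" for x y t
  proof -
    obtain p where p: "zigzag X x p y" "t = (x, zz_class X x p y, y)"
      using t unfolding localisation_hom_iff by blast
    then show ?thesis
      using localisation_comp[OF X, of x "[]" x p y] localisation_comp[OF X, of x p y "[]" y]
        zigzag_Ob[OF X p(1)] by simp
  qed
  moreover have "t'' \<cdot>\<^bsub>?G\<^esub> (t' \<cdot>\<^bsub>?G\<^esub> t) = (t'' \<cdot>\<^bsub>?G\<^esub> t') \<cdot>\<^bsub>?G\<^esub> t"
    if t: "t \<in> hom ?G w x" "t' \<in> hom ?G x y" "t'' \<in> hom ?G y z" for w x y z t t' t''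
  proof -
    obtain p q r where *: "zigzag X w p x" "zigzag X x q y" "zigzag X y r z"
        "t = (w, zz_class X w p x, x)" "t' = (x, zz_class X x q y, y)"
        "t'' = (y, zz_class X y r z, z)"
      using t unfolding localisation_hom_iff by blast
    then have "zigzag X w (p @ q) y" "zigzag X x (q @ r) z" using zigzag_append[OF X] by blast+
    then show ?thesis using * by (simp add: localisation_comp[OF X])
  qed
  ultimately show ?thesis unfolding category_def by blast
qed

text \<open>The two functor laws are precisely the generating relations
  \<open>zz_basic.ident\<close> and \<open>zz_basic.comp\<close>.\<close>

lemma is_functor_localisation_functor:
  assumes X: "category X"
  shows "is_functor X (localisation X) (localisation_functor X)"
proof -
  interpret cat X by (rule cat.intro[OF X])
  have far: "far (localisation_functor X) f = (a, zz_class X a [Fwd f] b, b)"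
    if "f \<in> hom X a b" for f a b
    using that by (auto simp: localisation_functor_def hom_iff)
  have zz: "zigzag X a [Fwd f] b" if "f \<in> hom X a b" for f a b
    using that hom_Ob[OF that] by (auto simp: hom_iff)
  have id: "zz_class X a [Fwd (Ident X a)] a = zz_class X a [] a" if "a \<in> Ob X" for a
    using zz_class_eqI[OF zz_basic.ident[OF that], of a "[]" "[]" a] zz[OF Ident_hom[OF that]] that
    by simp
  have comp: "zz_class X a [Fwd (g \<cdot>\<^bsub>X\<^esub> f)] c = zz_class X a ([Fwd f] @ [Fwd g]) c"
    if f: "f \<in> hom X a b" and g: "g \<in> hom X b c" for a b c f g
    using zz_class_eqI[OF zz_basic.comp[OF f g], of a "[]" "[]" c] zz[OF comp_hom[OF f g]]
      zz[OF f] zz[OF g] f g by (simp add: hom_iff)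
  show ?thesis
    unfolding is_functor_def
  proof (intro conjI ballI allI impI)
    show "fob (localisation_functor X) \<in> extensional (Ob X)"
      "far (localisation_functor X) \<in> extensional (Ar X)"
      by (simp_all add: localisation_functor_def)
    show fob: "fob (localisation_functor X) a \<in> Ob (localisation X)" if "a \<in> Ob X" for a
      using that by (simp add: localisation_functor_def)
    show "far (localisation_functor X) f \<in>
        hom (localisation X) (fob (localisation_functor X) a) (fob (localisation_functor X) b)"
      if "f \<in> hom X a b" for a b f
    proof -
      have "fob (localisation_functor X) a = a" "fob (localisation_functor X) b = b"
        using hom_Ob[OF that] by (simp_all add: localisation_functor_def)
      then show ?thesis
        using zz[OF that] unfolding far[OF that] localisation_hom_iff by metis
    qed
    show "far (localisation_functor X) (Ident X a) =
        Ident (localisation X) (fob (localisation_functor X) a)" if "a \<in> Ob X" for a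
      using that by (simp add: far[OF Ident_hom] id localisation_functor_def)
    show "far (localisation_functor X) (g \<cdot>\<^bsub>X\<^esub> f) =
        far (localisation_functor X) g \<cdot>\<^bsub>localisation X\<^esub> far (localisation_functor X) f"
      if "f \<in> hom X a b \<and> g \<in> hom X b c" for a b c f g
    proof -
      have f: "f \<in> hom X a b" and g: "g \<in> hom X b c" using that by auto
      show ?thesis
        unfolding far[OF f] far[OF g] far[OF comp_hom[OF f g]] comp[OF f g]
          localisation_comp[OF X zz[OF f] zz[OF g]] ..
    qed
  qed
qed

section \<open>Inverses by reversing zigzags\<close>

primrec reverse_step :: "'m step \<Rightarrow> 'm step" where
  "reverse_step (Fwd f) = Bwd f"
| "reverse_step (Bwd f) = Fwd f"

lemma reverse_step_reverse_step [simp]: "reverse_step (reverse_step s) = s"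
  by (cases s) simp_all

lemma zigzag_reverse:
  assumes X: "category X" and "zigzag X x p y"
  shows "zigzag X y (rev (map reverse_step p)) x"
  using assms(2)
proof (induction p arbitrary: x)
  case (Cons s p)
  then show ?case
  proof (cases s)
    case (Fwd f)
    with Cons show ?thesis
      using zigzag_Ob[OF X Cons.prems]
      by (auto simp: zigzag_append[OF X] intro!: exI[of _ "Cod X f"])
  next
    case (Bwd f)
    with Cons show ?thesis
      using zigzag_Ob[OF X Cons.prems]
      by (auto simp: zigzag_append[OF X] intro!: exI[of _ "Dom X f"])
  qed
qed auto

text \<open>Cancellation proceeds from the inside out: the induction hypothesis removes the tail and
  its reverse between \<open>s\<close> and \<open>reverse_step s\<close>, and what is left is one of
  the relations \<open>fwd_bwd\<close> and \<open>bwd_fwd\<close>.\<close>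

lemma zz_class_append_reverse:
  assumes X: "category X" and "zigzag X x p y"
  shows "zz_class X x (p @ rev (map reverse_step p)) x = zz_class X x [] x"
  using assms(2)
proof (induction p arbitrary: x)
  case (Cons s p)
  let ?r = "rev (map reverse_step p)"
  obtain z where s: "zigzag X x [s] z" and p: "zigzag X z p y"
    using Cons.prems zigzag_append[OF X, of x "[s]" p y] by auto
  have s': "zigzag X z [reverse_step s] x" using zigzag_reverse[OF X s] by simp
  have "equivclp (zz_rewrite X x x) ([s] @ (p @ ?r) @ [reverse_step s]) ([s] @ [] @ [reverse_step s])"
    using equivclp_zz_rewrite_append[OF X Cons.IH[OF p, unfolded zz_class_eq_iff] s s'] .
  then have "zz_class X x ([s] @ (p @ ?r) @ [reverse_step s]) x = zz_class X x [s, reverse_step s] x"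
    unfolding zz_class_eq_iff by simp
  also have "\<dots> = zz_class X x [] x"
  proof -
    have "zz_basic X [s, reverse_step s] []"
      using s by (cases s) (auto intro: zz_basic.intros)
    moreover have "zigzag X x [s, reverse_step s] x"
      using zigzag_append[OF X, of x "[s]" "[reverse_step s]" x] s s' by auto
    ultimately show ?thesis
      using zz_class_eqI[of X _ _ x "[]" "[]" x] zigzag_Ob[OF X s] by simp
  qed
  finally show ?case by simp
qed simp

text \<open>Reversing twice restores \<open>p\<close>, so the cancellation lemma applied to
  \<open>p\<close> and to its reverse gives both inverse laws.\<close>

lemma localisation_inverse:
  assumes X: "category X" and t: "t \<in> hom (localisation X) x y"
  obtains t' where "inverse_arrows (localisation X) t t'"
proof -
  obtain p where p: "zigzag X x p y" "t = (x, zz_class X x p y, y)"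
    using t unfolding localisation_hom_iff by blast
  let ?r = "rev (map reverse_step p)"
  have r: "zigzag X y ?r x" by (rule zigzag_reverse[OF X p(1)])
  have rr: "rev (map reverse_step ?r) = p" by (simp add: rev_map comp_def)
  have "inverse_arrows (localisation X) t (y, zz_class X y ?r x, x)"
    unfolding inverse_arrows_def
    using p r t localisation_comp[OF X p(1) r] localisation_comp[OF X r p(1)]
      zz_class_append_reverse[OF X p(1)] zz_class_append_reverse[OF X r, unfolded rr]
    by (auto simp: localisation_hom_iff hom_iff)
       (auto simp: localisation_def)
  then show ?thesis by (rule that)
qed

section \<open>Pointwise dependent products in functor categories\<close>

locale functor_category = E: cat E + J: cat J for J :: "('i, 'j) cat" and E :: "('o, 'm) cat"
begin

abbreviation F where "F \<equiv> functor_cat J E"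

section \<open>Natural transformations by components, and functors specified by unique
  arrows\<close>

lemma F_hom_iff:
  "t \<in> hom F G H \<longleftrightarrow> nat_trans J E G H (component t) \<and> t = (G, H, component t)"
  by (cases t) (auto simp: hom_def functor_cat_def component_def)

lemma F_hom_component:
  assumes "t \<in> hom F G H" "x \<in> Ob J"
  shows "component t x \<in> hom E (fob G x) (fob H x)"
  using assms by (simp add: F_hom_iff nat_trans_def)

lemma F_hom_natural:
  assumes "t \<in> hom F G H" "f \<in> hom J x y"
  shows "component t y \<cdot>\<^bsub>E\<^esub> far G f = far H f \<cdot>\<^bsub>E\<^esub> component t x"
  using assms unfolding F_hom_iff nat_trans_def by blast

lemma F_hom_functor:
  assumes "t \<in> hom F G H"
  shows "is_functor J E G" "is_functor J E H"
  using assms by (simp_all add: F_hom_iff nat_trans_def)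

lemma functorD:
  assumes "is_functor J E G"
  shows "f \<in> hom J x y \<Longrightarrow> far G f \<in> hom E (fob G x) (fob G y)"
    and "x \<in> Ob J \<Longrightarrow> fob G x \<in> Ob E"
    and "x \<in> Ob J \<Longrightarrow> far G (Ident J x) = Ident E (fob G x)"
    and "f \<in> hom J x y \<Longrightarrow> g \<in> hom J y z \<Longrightarrow> far G (g \<cdot>\<^bsub>J\<^esub> f) = far G g \<cdot>\<^bsub>E\<^esub> far G f"
  using assms unfolding is_functor_def by blast+

text \<open>Components are \<open>undefined\<close> off the objects, so agreement on objects is
  equality in HOL; every equation in the functor category reduces to equations in \<open>E\<close>
  this way.\<close>

lemma F_hom_eqI:
  assumes "s \<in> hom F G H" "t \<in> hom F G H"
    "\<And>x. x \<in> Ob J \<Longrightarrow> component s x = component t x"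
  shows "s = t"
proof -
  have "component s = component t"
    using assms by (intro extensionalityI[of _ "Ob J"]) (auto simp: F_hom_iff nat_trans_def)
  then show ?thesis using assms unfolding F_hom_iff by metis
qed

lemma F_homI:
  assumes "is_functor J E G" "is_functor J E H"
    and "\<And>x. x \<in> Ob J \<Longrightarrow> \<eta> x \<in> hom E (fob G x) (fob H x)"
    and "\<And>f x y. f \<in> hom J x y \<Longrightarrow> \<eta> y \<cdot>\<^bsub>E\<^esub> far G f = far H f \<cdot>\<^bsub>E\<^esub> \<eta> x"
  shows "(G, H, restrict \<eta> (Ob J)) \<in> hom F G H"
  using assms J.hom_Ob unfolding F_hom_iff nat_trans_def
  by (auto simp: component_def restrict_apply')

lemma component_triple [simp]: "component (G, H, \<eta>) = \<eta>"
  by (simp add: component_def)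

lemma F_Ident: "Ident F G = (G, G, \<lambda>x\<in>Ob J. Ident E (fob G x))"
  by (simp add: functor_cat_def)

lemma component_Ident [simp]: "x \<in> Ob J \<Longrightarrow> component (Ident F G) x = Ident E (fob G x)"
  by (simp add: F_Ident)

lemma component_comp [simp]:
  "x \<in> Ob J \<Longrightarrow> component (t \<cdot>\<^bsub>F\<^esub> s) x = component t x \<cdot>\<^bsub>E\<^esub> component s x"
  by (cases s; cases t) (simp add: functor_cat_def)

lemma F_comp_hom:
  assumes s: "s \<in> hom F G H" and t: "t \<in> hom F H K"
  shows "t \<cdot>\<^bsub>F\<^esub> s \<in> hom F G K"
proof -
  have "t \<cdot>\<^bsub>F\<^esub> s = (G, K, \<lambda>x\<in>Ob J. component t x \<cdot>\<^bsub>E\<^esub> component s x)"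
  proof -
    obtain \<sigma> \<tau> where "s = (G, H, \<sigma>)" "t = (H, K, \<tau>)" using s t unfolding F_hom_iff by blast
    then show ?thesis by (simp add: functor_cat_def)
  qed
  moreover have "(G, K, \<lambda>x\<in>Ob J. component t x \<cdot>\<^bsub>E\<^esub> component s x) \<in> hom F G K"
  proof (rule F_homI)
    show "is_functor J E G" "is_functor J E K" using F_hom_functor s t by blast+
    show "component t x \<cdot>\<^bsub>E\<^esub> component s x \<in> hom E (fob G x) (fob K x)" if "x \<in> Ob J" for x
      using F_hom_component s t that E.comp_hom by meson
    fix f x y
    assume f: "f \<in> hom J x y"
    note ob = J.hom_Ob[OF f]
    note h = F_hom_component[OF s conjunct1[OF ob]] F_hom_component[OF s conjunct2[OF ob]]
      F_hom_component[OF t conjunct1[OF ob]] F_hom_component[OF t conjunct2[OF ob]]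
      functorD(1)[OF F_hom_functor(1)[OF s] f] functorD(1)[OF F_hom_functor(2)[OF s] f]
      functorD(1)[OF F_hom_functor(2)[OF t] f]
    show "(component t y \<cdot>\<^bsub>E\<^esub> component s y) \<cdot>\<^bsub>E\<^esub> far G f =
        far K f \<cdot>\<^bsub>E\<^esub> component t x \<cdot>\<^bsub>E\<^esub> component s x"
      using h F_hom_natural[OF s f] E.comp_extend[OF F_hom_natural[OF t f], of "component s x"]
      by (simp add: hom_iff E.comp_assoc)
  qed
  ultimately show ?thesis by simp
qed

lemma category_F: "category F"
proof -
  have "\<forall>t\<in>Ar F. Dom F t \<in> Ob F \<and> Cod F t \<in> Ob F"
    by (auto simp: functor_cat_def nat_trans_def)
  moreover have id: "Ident F G \<in> hom F G G" if "G \<in> Ob F" for G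
  proof -
    have G: "is_functor J E G" using that by (simp add: functor_cat_def)
    show ?thesis
      unfolding F_Ident
    proof (rule F_homI[OF G G])
      show "Ident E (fob G x) \<in> hom E (fob G x) (fob G x)" if "x \<in> Ob J" for x
        using functorD(2)[OF G that] E.Ident_hom by blast
      show "Ident E (fob G y) \<cdot>\<^bsub>E\<^esub> far G f = far G f \<cdot>\<^bsub>E\<^esub> Ident E (fob G x)"
        if "f \<in> hom J x y" for f x y
        using functorD(1)[OF G that] by (simp add: hom_iff)
    qed
  qed
  moreover have "t \<cdot>\<^bsub>F\<^esub> Ident F G = t \<and> Ident F H \<cdot>\<^bsub>F\<^esub> t = t" if t: "t \<in> hom F G H" for G H t
  proof -
    have "G \<in> Ob F" "H \<in> Ob F" using F_hom_functor[OF t] by (simp_all add: functor_cat_def)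
    then have "t \<cdot>\<^bsub>F\<^esub> Ident F G \<in> hom F G H" "Ident F H \<cdot>\<^bsub>F\<^esub> t \<in> hom F G H"
      using id F_comp_hom t by blast+
    moreover have "component t x \<in> Ar E \<and> Dom E (component t x) = fob G x \<and>
        Cod E (component t x) = fob H x" if "x \<in> Ob J" for x
      using F_hom_component[OF t that] by (simp add: hom_iff)
    ultimately show ?thesis using t by (auto intro!: F_hom_eqI)
  qed
  moreover have "t \<cdot>\<^bsub>F\<^esub> (s \<cdot>\<^bsub>F\<^esub> r) = (t \<cdot>\<^bsub>F\<^esub> s) \<cdot>\<^bsub>F\<^esub> r"
    if r: "r \<in> hom F G H" and s: "s \<in> hom F H K" and t: "t \<in> hom F K L" for G H K L r s t
  proof (rule F_hom_eqI)
    show "t \<cdot>\<^bsub>F\<^esub> (s \<cdot>\<^bsub>F\<^esub> r) \<in> hom F G L" "(t \<cdot>\<^bsub>F\<^esub> s) \<cdot>\<^bsub>F\<^esub> r \<in> hom F G L"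
      using F_comp_hom r s t by blast+
    show "component (t \<cdot>\<^bsub>F\<^esub> (s \<cdot>\<^bsub>F\<^esub> r)) x = component ((t \<cdot>\<^bsub>F\<^esub> s) \<cdot>\<^bsub>F\<^esub> r) x" if "x \<in> Ob J" for x
      using F_hom_component[OF r that] F_hom_component[OF s that] F_hom_component[OF t that] that
      by (simp add: hom_iff E.comp_assoc)
  qed
  ultimately show ?thesis
    unfolding category_def using F_comp_hom by blast
qed

sublocale F: cat F
  by (rule cat.intro[OF category_F])

text \<open>When each arrow of \<open>J\<close> has a unique counterpart satisfying
  \<open>R\<close>, closure of \<open>R\<close> under identities and composition is functoriality.
  This produces both the vertex of an objectwise pullback, with \<open>R\<close> expressing
  naturality of the legs, and the domain of the dependent product, with \<open>R\<close> expressing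
  transposition.\<close>

lemma functor_from_relation:
  assumes ob: "\<And>x. x \<in> Ob J \<Longrightarrow> obj x \<in> Ob E"
    and ex1: "\<And>f x y. f \<in> hom J x y \<Longrightarrow> \<exists>!u. u \<in> hom E (obj x) (obj y) \<and> R f u"
    and id: "\<And>x. x \<in> Ob J \<Longrightarrow> R (Ident J x) (Ident E (obj x))"
    and comp: "\<And>f g x y z u v. f \<in> hom J x y \<Longrightarrow> g \<in> hom J y z \<Longrightarrow>
      u \<in> hom E (obj x) (obj y) \<Longrightarrow> v \<in> hom E (obj y) (obj z) \<Longrightarrow> R f u \<Longrightarrow> R g v \<Longrightarrow> R (g \<cdot>\<^bsub>J\<^esub> f) (v \<cdot>\<^bsub>E\<^esub> u)"
  obtains G where "is_functor J E G" "\<And>x. x \<in> Ob J \<Longrightarrow> fob G x = obj x"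
    "\<And>f x y. f \<in> hom J x y \<Longrightarrow> R f (far G f)"
proof -
  define G1 where "G1 f = (THE u. u \<in> hom E (obj (Dom J f)) (obj (Cod J f)) \<and> R f u)" for f
  define G where "G = \<lparr>fob = restrict obj (Ob J), far = restrict G1 (Ar J)\<rparr>"
  have fob: "fob G x = obj x" if "x \<in> Ob J" for x using that by (simp add: G_def)
  have far: "far G f \<in> hom E (obj x) (obj y) \<and> R f (far G f)" if f: "f \<in> hom J x y" for f x y
  proof -
    have "far G f = (THE u. u \<in> hom E (obj x) (obj y) \<and> R f u)"
      using f by (simp add: G_def G1_def hom_iff)
    then show ?thesis using theI'[OF ex1[OF f]] by simp
  qed
  have far_eq: "u = far G f" if f: "f \<in> hom J x y" and "u \<in> hom E (obj x) (obj y)" "R f u" for f x y u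
    using ex1[OF f] far[OF f] that by blast
  have "is_functor J E G"
    unfolding is_functor_def
  proof (intro conjI ballI allI impI)
    show "fob G \<in> extensional (Ob J)" "far G \<in> extensional (Ar J)" by (simp_all add: G_def)
    show "fob G x \<in> Ob E" if "x \<in> Ob J" for x using that ob fob by simp
    show "far G f \<in> hom E (fob G x) (fob G y)" if "f \<in> hom J x y" for x y f
      using far[OF that] fob J.hom_Ob[OF that] by simp
    show "far G (Ident J x) = Ident E (fob G x)" if "x \<in> Ob J" for x
      using far_eq[OF J.Ident_hom[OF that] E.Ident_hom[OF ob[OF that]] id[OF that]] fob that by simp
    fix x y z f g
    assume "f \<in> hom J x y \<and> g \<in> hom J y z"
    then have f: "f \<in> hom J x y" and g: "g \<in> hom J y z" by auto
    show "far G (g \<cdot>\<^bsub>J\<^esub> f) = far G g \<cdot>\<^bsub>E\<^esub> far G f"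
      using far_eq[OF J.comp_hom[OF f g] E.comp_hom] comp[OF f g] far[OF f] far[OF g] by metis
  qed
  then show ?thesis using that fob far by blast
qed

section \<open>Pullbacks computed objectwise\<close>

lemma pointwise_pullback:
  assumes h: "h \<in> hom F B A" and g: "g \<in> hom F D A" and p: "p \<in> hom F V B" and q: "q \<in> hom F V D"
    and pb: "\<And>x. x \<in> Ob J \<Longrightarrow>
      is_pullback E (component h x) (component g x) (component p x) (component q x)"
  shows "is_pullback F h g p q"
proof (rule F.is_pullbackI)
  show "h \<in> Ar F" "g \<in> Ar F" "p \<in> Ar F" "q \<in> Ar F" "Cod F h = Cod F g" "Dom F q = Dom F p"
    "Cod F p = Dom F h" "Cod F q = Dom F g"
    using h g p q by (simp_all add: hom_iff)
  show "h \<cdot>\<^bsub>F\<^esub> p = g \<cdot>\<^bsub>F\<^esub> q"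
    using F_hom_eqI[OF F_comp_hom[OF p h] F_comp_hom[OF q g]] E.is_pullbackD(9)[OF pb] by simp
next
  fix W p' q'
  assume "p' \<in> hom F W (Dom F h)" "q' \<in> hom F W (Dom F g)" and eq: "h \<cdot>\<^bsub>F\<^esub> p' = g \<cdot>\<^bsub>F\<^esub> q'"
  then have p': "p' \<in> hom F W B" and q': "q' \<in> hom F W D" using h g by (simp_all add: hom_iff)
  have dom: "Dom E (component p x) = fob V x" if "x \<in> Ob J" for x
    using F_hom_component[OF p that] by (simp add: hom_iff)
  have "\<exists>u. u \<in> hom E (fob W x) (fob V x) \<and> component p x \<cdot>\<^bsub>E\<^esub> u = component p' x \<and>
      component q x \<cdot>\<^bsub>E\<^esub> u = component q' x" if x: "x \<in> Ob J" for x
  proof -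
    have "component h x \<cdot>\<^bsub>E\<^esub> component p' x = component g x \<cdot>\<^bsub>E\<^esub> component q' x"
      using eq x component_comp by metis
    then show ?thesis
      using E.pullback_lift[OF pb[OF x], of "component p' x" "fob W x" "component q' x"] dom[OF x]
        F_hom_component[OF p' x] F_hom_component[OF q' x] F_hom_component[OF h x]
        F_hom_component[OF g x]
      unfolding hom_iff by metis
  qed
  then obtain u where u: "\<And>x. x \<in> Ob J \<Longrightarrow> u x \<in> hom E (fob W x) (fob V x)"
      "\<And>x. x \<in> Ob J \<Longrightarrow> component p x \<cdot>\<^bsub>E\<^esub> u x = component p' x"
      "\<And>x. x \<in> Ob J \<Longrightarrow> component q x \<cdot>\<^bsub>E\<^esub> u x = component q' x"
    by metis
  have U: "(W, V, restrict u (Ob J)) \<in> hom F W V"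
  proof (rule F_homI[OF F_hom_functor(1)[OF p'] F_hom_functor(1)[OF p] u(1)])
    fix f x y
    assume f: "f \<in> hom J x y"
    have xy: "x \<in> Ob J" "y \<in> Ob J" using J.hom_Ob[OF f] by auto
    have W: "far W f \<in> hom E (fob W x) (fob W y)" and V: "far V f \<in> hom E (fob V x) (fob V y)"
      using functorD(1) F_hom_functor p' p f by blast+
    have ar: "component r y \<in> hom E (fob V y) (fob S y)" "component r x \<in> hom E (fob V x) (fob S x)"
      "far S f \<in> hom E (fob S x) (fob S y)" if "r \<in> hom F V S" for r S
      using F_hom_component[OF that] xy functorD(1)[OF F_hom_functor(2)[OF that] f] by blast+
    \<comment> \<open>Naturality of the objectwise lifts is tested after composing with a leg. The
      computation is the same for \<open>p\<close> and \<open>q\<close>, hence the generic leg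
      \<open>r\<close>; joint monicity at \<open>y\<close> then finishes.\<close>
    have step: "component r y \<cdot>\<^bsub>E\<^esub> u y \<cdot>\<^bsub>E\<^esub> far W f = component r y \<cdot>\<^bsub>E\<^esub> far V f \<cdot>\<^bsub>E\<^esub> u x"
      if r: "r \<in> hom F V S" and r': "r' \<in> hom F W S"
        and ru: "\<And>x. x \<in> Ob J \<Longrightarrow> component r x \<cdot>\<^bsub>E\<^esub> u x = component r' x" for r r' S
    proof -
      have "component r y \<cdot>\<^bsub>E\<^esub> u y \<cdot>\<^bsub>E\<^esub> far W f = component r' y \<cdot>\<^bsub>E\<^esub> far W f"
        using ar[OF r] W u(1)[OF xy(2)] by (intro E.comp_extend[OF ru[OF xy(2)]]) (simp_all add: hom_iff)
      also have "\<dots> = far S f \<cdot>\<^bsub>E\<^esub> component r' x" by (rule F_hom_natural[OF r' f])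
      also have "\<dots> = (far S f \<cdot>\<^bsub>E\<^esub> component r x) \<cdot>\<^bsub>E\<^esub> u x"
        using ar[OF r] u(1)[OF xy(1)] ru[OF xy(1)] by (simp add: hom_iff E.comp_assoc)
      also have "\<dots> = component r y \<cdot>\<^bsub>E\<^esub> far V f \<cdot>\<^bsub>E\<^esub> u x"
        unfolding F_hom_natural[OF r f, symmetric]
        using ar[OF r] u(1)[OF xy(1)] V by (simp add: hom_iff E.comp_assoc)
      finally show ?thesis .
    qed
    show "u y \<cdot>\<^bsub>E\<^esub> far W f = far V f \<cdot>\<^bsub>E\<^esub> u x"
      using E.pullback_eqI[OF pb[OF xy(2)], of "u y \<cdot>\<^bsub>E\<^esub> far W f" "fob W x" "far V f \<cdot>\<^bsub>E\<^esub> u x"]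
        E.comp_hom[OF W u(1)[OF xy(2)]] E.comp_hom[OF u(1)[OF xy(1)] V] dom[OF xy(2)]
        step[OF p p' u(2)] step[OF q q' u(3)] by simp
  qed
  have "p \<cdot>\<^bsub>F\<^esub> (W, V, restrict u (Ob J)) = p'" "q \<cdot>\<^bsub>F\<^esub> (W, V, restrict u (Ob J)) = q'"
    using F_comp_hom[OF U p] F_comp_hom[OF U q] p' q' u(2,3)
    by (auto intro: F_hom_eqI)
  then show "\<exists>u. u \<in> hom F W (Dom F p) \<and> p \<cdot>\<^bsub>F\<^esub> u = p' \<and> q \<cdot>\<^bsub>F\<^esub> u = q'"
    using U p unfolding hom_iff by blast
next
  fix W u u'
  assume "u \<in> hom F W (Dom F p)" "u' \<in> hom F W (Dom F p)"
    and eq: "p \<cdot>\<^bsub>F\<^esub> u = p \<cdot>\<^bsub>F\<^esub> u'" "q \<cdot>\<^bsub>F\<^esub> u = q \<cdot>\<^bsub>F\<^esub> u'"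
  then have u: "u \<in> hom F W V" "u' \<in> hom F W V" using p by (simp_all add: hom_iff)
  show "u = u'"
  proof (rule F_hom_eqI[OF u])
    fix x
    assume x: "x \<in> Ob J"
    have "Dom E (component p x) = fob V x" using F_hom_component[OF p x] by (simp add: hom_iff)
    moreover have "component p x \<cdot>\<^bsub>E\<^esub> component u x = component p x \<cdot>\<^bsub>E\<^esub> component u' x"
      "component q x \<cdot>\<^bsub>E\<^esub> component u x = component q x \<cdot>\<^bsub>E\<^esub> component u' x"
      using eq x component_comp by metis+
    ultimately show "component u x = component u' x"
      using E.pullback_eqI[OF pb[OF x]] F_hom_component[OF u(1) x] F_hom_component[OF u(2) x]
      by metis
  qed
qed

text \<open>The components of the legs are prescribed exactly, not merely up to isomorphism. This
  allows a pullback to be built on squares already tied to given objectwise data, such as those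
  under the counits.\<close>

lemma extend_pointwise_pullback:
  assumes h: "h \<in> hom F B A" and g: "g \<in> hom F D A"
    and pb: "\<And>x. x \<in> Ob J \<Longrightarrow> is_pullback E (component h x) (component g x) (p0 x) (q0 x)"
  obtains V p q where "p \<in> hom F V B" "q \<in> hom F V D"
    "\<And>x. x \<in> Ob J \<Longrightarrow> component p x = p0 x" "\<And>x. x \<in> Ob J \<Longrightarrow> component q x = q0 x"
    "is_pullback F h g p q"
proof -
  have p0: "p0 x \<in> hom E (Dom E (p0 x)) (fob B x)" and q0: "q0 x \<in> hom E (Dom E (p0 x)) (fob D x)"
    if "x \<in> Ob J" for x
    using E.is_pullbackD[OF pb[OF that]] F_hom_component[OF h that] F_hom_component[OF g that]
    by (simp_all add: hom_iff)
  have B: "is_functor J E B" and D: "is_functor J E D" and A: "is_functor J E A"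
    using F_hom_functor h g by blast+
  \<comment> \<open>\<open>?R f u\<close> says that both legs are natural at \<open>f\<close>. The
    endpoints are written through \<open>Dom J f\<close> and \<open>Cod J f\<close> because
    \<open>functor_from_relation\<close> takes a relation on arrows alone.\<close>
  let ?R = "\<lambda>f u. p0 (Cod J f) \<cdot>\<^bsub>E\<^esub> u = far B f \<cdot>\<^bsub>E\<^esub> p0 (Dom J f) \<and>
    q0 (Cod J f) \<cdot>\<^bsub>E\<^esub> u = far D f \<cdot>\<^bsub>E\<^esub> q0 (Dom J f)"
  obtain V where V: "is_functor J E V" "\<And>x. x \<in> Ob J \<Longrightarrow> fob V x = Dom E (p0 x)"
    "\<And>f x y. f \<in> hom J x y \<Longrightarrow> ?R f (far V f)"
  proof (rule functor_from_relation[where obj = "\<lambda>x. Dom E (p0 x)" and R = ?R])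
    fix x assume x: "x \<in> Ob J"
    show "Dom E (p0 x) \<in> Ob E" using E.is_pullbackD(3)[OF pb[OF x]] by simp
    show "?R (Ident J x) (Ident E (Dom E (p0 x)))"
      using p0[OF x] q0[OF x] x functorD(3)[OF B x] functorD(3)[OF D x] by (simp add: hom_iff)
  next
    fix f x y assume f: "f \<in> hom J x y"
    have xy: "x \<in> Ob J" "y \<in> Ob J" using J.hom_Ob[OF f] by auto
    note ar = p0[OF xy(1)] p0[OF xy(2)] q0[OF xy(1)] q0[OF xy(2)] functorD(1)[OF B f]
      functorD(1)[OF D f] functorD(1)[OF A f] F_hom_component[OF h xy(1)] F_hom_component[OF h xy(2)]
      F_hom_component[OF g xy(1)] F_hom_component[OF g xy(2)]
    have "component h y \<cdot>\<^bsub>E\<^esub> far B f \<cdot>\<^bsub>E\<^esub> p0 x = far A f \<cdot>\<^bsub>E\<^esub> component h x \<cdot>\<^bsub>E\<^esub> p0 x"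
      using ar E.comp_extend[OF F_hom_natural[OF h f], of "p0 x"] by (simp add: hom_iff E.comp_assoc)
    also have "\<dots> = far A f \<cdot>\<^bsub>E\<^esub> component g x \<cdot>\<^bsub>E\<^esub> q0 x"
      using E.is_pullbackD(9)[OF pb[OF xy(1)]] by simp
    also have "\<dots> = component g y \<cdot>\<^bsub>E\<^esub> far D f \<cdot>\<^bsub>E\<^esub> q0 x"
      using ar E.comp_extend[OF F_hom_natural[OF g f], of "q0 x"] by (simp add: hom_iff E.comp_assoc)
    finally have eq: "component h y \<cdot>\<^bsub>E\<^esub> far B f \<cdot>\<^bsub>E\<^esub> p0 x = component g y \<cdot>\<^bsub>E\<^esub> far D f \<cdot>\<^bsub>E\<^esub> q0 x" .
    have "\<exists>!u. u \<in> hom E (Dom E (p0 x)) (Dom E (p0 y)) \<and>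
      p0 y \<cdot>\<^bsub>E\<^esub> u = far B f \<cdot>\<^bsub>E\<^esub> p0 x \<and> q0 y \<cdot>\<^bsub>E\<^esub> u = far D f \<cdot>\<^bsub>E\<^esub> q0 x"
    proof -
      have "far B f \<cdot>\<^bsub>E\<^esub> p0 x \<in> hom E (Dom E (p0 x)) (Dom E (component h y))"
        "far D f \<cdot>\<^bsub>E\<^esub> q0 x \<in> hom E (Dom E (p0 x)) (Dom E (component g y))"
        using ar by (simp_all add: hom_iff)
      from E.pullback_lift[OF pb[OF xy(2)] this eq] E.pullback_eqI[OF pb[OF xy(2)]]
      show ?thesis by metis
    qed
    then show "\<exists>!u. u \<in> hom E (Dom E (p0 x)) (Dom E (p0 y)) \<and> ?R f u"
      using f by (simp add: hom_iff)
  next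
    fix f g x y z u v
    assume f: "f \<in> hom J x y" and g: "g \<in> hom J y z"
      and u: "u \<in> hom E (Dom E (p0 x)) (Dom E (p0 y))" "?R f u"
      and v: "v \<in> hom E (Dom E (p0 y)) (Dom E (p0 z))" "?R g v"
    have xyz: "x \<in> Ob J" "y \<in> Ob J" "z \<in> Ob J" using J.hom_Ob f g by auto
    have *: "r z \<cdot>\<^bsub>E\<^esub> v \<cdot>\<^bsub>E\<^esub> u = far S (g \<cdot>\<^bsub>J\<^esub> f) \<cdot>\<^bsub>E\<^esub> r x"
      if S: "is_functor J E S" and r: "\<And>x. x \<in> Ob J \<Longrightarrow> r x \<in> hom E (Dom E (p0 x)) (fob S x)"
        and ru: "r y \<cdot>\<^bsub>E\<^esub> u = far S f \<cdot>\<^bsub>E\<^esub> r x" and rv: "r z \<cdot>\<^bsub>E\<^esub> v = far S g \<cdot>\<^bsub>E\<^esub> r y" for r S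
      using r[OF xyz(1)] r[OF xyz(2)] r[OF xyz(3)] u(1) v(1) functorD(1)[OF S f] functorD(1)[OF S g]
      by (simp add: functorD(4)[OF S f g] E.comp_extend[OF rv] E.comp_assoc ru hom_iff)
    show "?R (g \<cdot>\<^bsub>J\<^esub> f) (v \<cdot>\<^bsub>E\<^esub> u)"
      using *[OF B p0] *[OF D q0] u(2) v(2) f g J.comp_hom[OF f g] by (simp add: hom_iff)
  qed (rule that)
  have nat: "(V, S, restrict r (Ob J)) \<in> hom F V S"
    if S: "is_functor J E S" and r: "\<And>x. x \<in> Ob J \<Longrightarrow> r x \<in> hom E (Dom E (p0 x)) (fob S x)"
      and "\<And>f x y. f \<in> hom J x y \<Longrightarrow> r y \<cdot>\<^bsub>E\<^esub> far V f = far S f \<cdot>\<^bsub>E\<^esub> r x" for S r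
    using that V(2) by (intro F_homI[OF V(1) S]) simp_all
  have "(V, B, restrict p0 (Ob J)) \<in> hom F V B" "(V, D, restrict q0 (Ob J)) \<in> hom F V D"
    using nat[OF B p0] nat[OF D q0] V(3) by (auto simp: hom_iff)
  moreover from this have "is_pullback F h g (V, B, restrict p0 (Ob J)) (V, D, restrict q0 (Ob J))"
    using pb by (intro pointwise_pullback[OF h g]) simp_all
  ultimately show ?thesis using that by simp
qed

lemma pullbacks_along_pointwise:
  assumes h: "h \<in> hom F B A" and pb: "\<And>x. x \<in> Ob J \<Longrightarrow> pullbacks_along E (component h x)"
  shows "pullbacks_along F h"
  unfolding pullbacks_along_def
proof (intro conjI ballI impI)
  show "h \<in> Ar F" using h by (simp add: hom_iff)
  fix g
  assume "g \<in> Ar F" "Cod F g = Cod F h"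
  then have g: "g \<in> hom F (Dom F g) A" using h by (simp add: hom_iff)
  have "\<exists>p q. is_pullback E (component h x) (component g x) p q" if "x \<in> Ob J" for x
    using pb[OF that] F_hom_component[OF g that] F_hom_component[OF h that]
    unfolding pullbacks_along_def hom_iff by metis
  then obtain p0 q0 where
    "\<And>x. x \<in> Ob J \<Longrightarrow> is_pullback E (component h x) (component g x) (p0 x) (q0 x)"
    by metis
  then show "\<exists>p q. is_pullback F h g p q"
    using extend_pointwise_pullback[OF h g] by metis
qed

lemma natural_extend:
  assumes t: "t \<in> hom F G H" and f: "f \<in> hom J x y" and a: "a \<in> Ar E" "Cod E a = fob G x"
  shows "component t y \<cdot>\<^bsub>E\<^esub> far G f \<cdot>\<^bsub>E\<^esub> a = far H f \<cdot>\<^bsub>E\<^esub> component t x \<cdot>\<^bsub>E\<^esub> a"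
proof -
  have xy: "x \<in> Ob J" "y \<in> Ob J" using J.hom_Ob[OF f] by auto
  show ?thesis
    using E.comp_extend[OF F_hom_natural[OF t f], of a] a F_hom_component[OF t xy(1)]
      F_hom_component[OF t xy(2)] functorD(1)[OF F_hom_functor(1)[OF t] f]
      functorD(1)[OF F_hom_functor(2)[OF t] f]
    by (simp add: hom_iff E.comp_assoc)
qed

lemma transposes_component:
  assumes "P \<in> hom F Q A" "p \<in> hom F W B" "d \<in> hom F D A" "p' \<in> hom F V B"
    and u: "F.transposes P p q e d p' q' s u" and x: "x \<in> Ob J"
  shows "E.transposes (component P x) (component p x) (component q x) (component e x)
    (component d x) (component p' x) (component q' x) (component s x) (component u x)"
proof -
  have dom: "Dom F P = Q" "Dom F p = W" "Dom F d = D" "Dom F p' = V"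
    using assms(1-4) by (simp_all add: hom_iff)
  obtain v where u: "u \<in> hom F D Q" "P \<cdot>\<^bsub>F\<^esub> u = d" and v: "v \<in> hom F V W"
      "p \<cdot>\<^bsub>F\<^esub> v = p'" "q \<cdot>\<^bsub>F\<^esub> v = u \<cdot>\<^bsub>F\<^esub> q'" "e \<cdot>\<^bsub>F\<^esub> v = s"
    using u unfolding F.transposes_def dom by blast
  have "component P x \<cdot>\<^bsub>E\<^esub> component u x = component d x"
    "component p x \<cdot>\<^bsub>E\<^esub> component v x = component p' x"
    "component q x \<cdot>\<^bsub>E\<^esub> component v x = component u x \<cdot>\<^bsub>E\<^esub> component q' x"
    "component e x \<cdot>\<^bsub>E\<^esub> component v x = component s x"
    using u v component_comp[OF x] by metis+
  moreover have "component u x \<in> hom E (Dom E (component d x)) (Dom E (component P x))"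
    "component v x \<in> hom E (Dom E (component p' x)) (Dom E (component p x))"
    using assms(1-4)[THEN F_hom_component, OF x] F_hom_component[OF u(1) x] F_hom_component[OF v(1) x]
    by (simp_all add: hom_iff)
  ultimately show ?thesis unfolding E.transposes_def by blast
qed

section \<open>Cartesian (equifibred) transformations and objectwise dependent products\<close>

definition cartesian where
  "cartesian h \<longleftrightarrow> (\<forall>x y. \<forall>f\<in>hom J x y. is_pullback E (component h y)
     (far (Cod F h) f) (far (Dom F h) f) (component h x))"

lemma cartesianD:
  assumes "cartesian h" "h \<in> hom F B A" "f \<in> hom J x y"
  shows "is_pullback E (component h y) (far A f) (far B f) (component h x)"
  using assms by (auto simp: cartesian_def hom_iff[of h])

lemma cartesian_if_invertible:
  assumes h: "h \<in> hom F B A" and inv: "\<And>x y f. f \<in> hom J x y \<Longrightarrow> \<exists>g. inverse_arrows J f g"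
  shows "cartesian h"
  unfolding cartesian_def
proof (intro allI ballI)
  fix x y f
  assume f: "f \<in> hom J x y"
  obtain g where g: "inverse_arrows J f g" using inv[OF f] by blast
  then have gf: "g \<in> hom J y x" "g \<cdot>\<^bsub>J\<^esub> f = Ident J x" "f \<cdot>\<^bsub>J\<^esub> g = Ident J y"
    using f by (simp_all add: inverse_arrows_def hom_iff)
  have xy: "x \<in> Ob J" "y \<in> Ob J" using J.hom_Ob[OF f] by auto
  have far_inv: "inverse_arrows E (far G f) (far G g)" if G: "is_functor J E G" for G
    using functorD(1)[OF G f] functorD(1)[OF G gf(1)] functorD(4)[OF G f gf(1)]
      functorD(4)[OF G gf(1) f] functorD(3)[OF G xy(1)] functorD(3)[OF G xy(2)] gf
    by (simp add: inverse_arrows_def hom_iff)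
  note A = F_hom_functor(2)[OF h] and B = F_hom_functor(1)[OF h]
  have "is_pullback E (component h y) (far A f) (far B f) (component h x)"
    using E.commuting_square_of_isos_is_pullback[OF _ _ _ _ _ _ _ _ F_hom_natural[OF h f]
        far_inv[OF A] far_inv[OF B]]
      F_hom_component[OF h xy(1)] F_hom_component[OF h xy(2)] functorD(1)[OF A f] functorD(1)[OF B f]
    by (simp add: hom_iff)
  then show "is_pullback E (component h y) (far (Cod F h) f) (far (Dom F h) f) (component h x)"
    using h by (simp add: hom_iff)
qed

text \<open>The transposes \<open>u x\<close> exist separately at each object; the substance is
  their naturality. It is an instance of uniqueness at \<open>y\<close>, applied to arrows out of
  \<open>D x\<close>, which is possible because the naturality square of \<open>h\<close> can be
  pasted below the pullback at \<open>x\<close>.\<close>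

lemma ex1_transposes_pointwise:
  assumes h: "h \<in> hom F B A" and k: "k \<in> hom F C B" and P: "P \<in> hom F Q A"
    and p: "p \<in> hom F W B" and q: "q \<in> hom F W Q" and e: "e \<in> hom F W C"
    and cart: "cartesian h"
    and ev: "\<And>x. x \<in> Ob J \<Longrightarrow> E.evaluation (component h x) (component k x) (component P x)
      (component p x) (component q x) (component e x)"
    and d: "d \<in> hom F D A" and p': "p' \<in> hom F V B" and q': "q' \<in> hom F V D"
    and s: "s \<in> hom F V C" and ks: "k \<cdot>\<^bsub>F\<^esub> s = p'"
    and pb': "\<And>x. x \<in> Ob J \<Longrightarrow>
      is_pullback E (component h x) (component d x) (component p' x) (component q' x)"
  shows "\<exists>!u. F.transposes P p q e d p' q' s u"
proof -
  have pb: "is_pullback E (component h x) (component P x) (component p x) (component q x)"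
    and univ: "\<And>d p' q' s. is_pullback E (component h x) d p' q' \<Longrightarrow>
      s \<in> hom E (Dom E p') (Dom E (component k x)) \<Longrightarrow> component k x \<cdot>\<^bsub>E\<^esub> s = p' \<Longrightarrow>
      \<exists>!u. E.transposes (component P x) (component p x) (component q x) (component e x) d p' q' s u"
    if "x \<in> Ob J" for x
    using ev[OF that] unfolding E.evaluation_def by blast+
  let ?tr = "\<lambda>x. E.transposes (component P x) (component p x) (component q x) (component e x)
    (component d x) (component p' x) (component q' x) (component s x)"
  have ex1: "\<exists>!u. ?tr x u" if x: "x \<in> Ob J" for x
  proof (rule univ[OF x pb'[OF x]])
    show "component s x \<in> hom E (Dom E (component p' x)) (Dom E (component k x))"
      using F_hom_component[OF s x] F_hom_component[OF p' x] F_hom_component[OF k x]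
      by (simp add: hom_iff)
    show "component k x \<cdot>\<^bsub>E\<^esub> component s x = component p' x"
      using ks component_comp[OF x] by metis
  qed
  then obtain u where tr: "\<And>x. x \<in> Ob J \<Longrightarrow> ?tr x (u x)" by metis
  have "\<exists>v. v \<in> hom E (fob V x) (fob W x) \<and>
      component p x \<cdot>\<^bsub>E\<^esub> v = component p' x \<and>
      component q x \<cdot>\<^bsub>E\<^esub> v = u x \<cdot>\<^bsub>E\<^esub> component q' x \<and>
      component e x \<cdot>\<^bsub>E\<^esub> v = component s x" if x: "x \<in> Ob J" for x
  proof -
    have "Dom E (component p' x) = fob V x" "Dom E (component p x) = fob W x"
      using F_hom_component[OF p' x] F_hom_component[OF p x] by (simp_all add: hom_iff)
    then show ?thesis using tr[OF x] unfolding E.transposes_def by auto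
  qed
  then obtain v where v: "\<And>x. x \<in> Ob J \<Longrightarrow> v x \<in> hom E (fob V x) (fob W x)"
      "\<And>x. x \<in> Ob J \<Longrightarrow> component p x \<cdot>\<^bsub>E\<^esub> v x = component p' x"
      "\<And>x. x \<in> Ob J \<Longrightarrow> component q x \<cdot>\<^bsub>E\<^esub> v x = u x \<cdot>\<^bsub>E\<^esub> component q' x"
      "\<And>x. x \<in> Ob J \<Longrightarrow> component e x \<cdot>\<^bsub>E\<^esub> v x = component s x"
    by metis
  have u: "u x \<in> hom E (fob D x) (fob Q x)" "component P x \<cdot>\<^bsub>E\<^esub> u x = component d x"
    if x: "x \<in> Ob J" for x
    using tr[OF x] F_hom_component[OF d x] F_hom_component[OF P x]
    unfolding E.transposes_def hom_iff by simp_all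
  note functors = F_hom_functor(2)[OF h] F_hom_functor(1)[OF h] F_hom_functor(1)[OF k]
    F_hom_functor(1)[OF d] F_hom_functor(1)[OF P] F_hom_functor(1)[OF p] F_hom_functor(1)[OF p']
  have U: "(D, Q, restrict u (Ob J)) \<in> hom F D Q"
  proof (rule F_homI[OF functors(4,5) u(1)])
    fix f x y
    assume f: "f \<in> hom J x y"
    have x: "x \<in> Ob J" and y: "y \<in> Ob J" using J.hom_Ob[OF f] by auto
    note hx = h[THEN F_hom_component, OF x] k[THEN F_hom_component, OF x]
      P[THEN F_hom_component, OF x] p[THEN F_hom_component, OF x] q[THEN F_hom_component, OF x]
      e[THEN F_hom_component, OF x] d[THEN F_hom_component, OF x] p'[THEN F_hom_component, OF x]
      q'[THEN F_hom_component, OF x] s[THEN F_hom_component, OF x] u(1)[OF x] v(1)[OF x]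
    note hy = h[THEN F_hom_component, OF y] k[THEN F_hom_component, OF y]
      P[THEN F_hom_component, OF y] p[THEN F_hom_component, OF y] q[THEN F_hom_component, OF y]
      e[THEN F_hom_component, OF y] d[THEN F_hom_component, OF y] p'[THEN F_hom_component, OF y]
      q'[THEN F_hom_component, OF y] s[THEN F_hom_component, OF y] u(1)[OF y] v(1)[OF y]
    note hf = functors[THEN functorD(1), OF f]
    note ar = hx[unfolded hom_iff] hy[unfolded hom_iff] hf[unfolded hom_iff]
    let ?d = "far A f \<cdot>\<^bsub>E\<^esub> component d x" and ?p = "far B f \<cdot>\<^bsub>E\<^esub> component p' x"
      and ?q = "component q' x" and ?s = "far C f \<cdot>\<^bsub>E\<^esub> component s x"
    let ?try = "E.transposes (component P y) (component p y) (component q y) (component e y) ?d ?p ?q ?s"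
    have pbf: "is_pullback E (component h y) ?d ?p ?q"
      by (rule E.pullback_pasting[OF cartesianD[OF cart h f] pb'[OF x]])
    have "component k y \<cdot>\<^bsub>E\<^esub> ?s = far B f \<cdot>\<^bsub>E\<^esub> component k x \<cdot>\<^bsub>E\<^esub> component s x"
      using natural_extend[OF k f] ar by simp
    also have "\<dots> = ?p" using ks component_comp[OF x] by metis
    finally have "\<exists>!w. ?try w"
      using ar by (intro univ[OF y pbf]) (simp_all add: hom_iff)
    moreover have "?try (far Q f \<cdot>\<^bsub>E\<^esub> u x)"
      unfolding E.transposes_def
    proof (intro conjI bexI)
      show "far Q f \<cdot>\<^bsub>E\<^esub> u x \<in> hom E (Dom E ?d) (Dom E (component P y))"
        "far W f \<cdot>\<^bsub>E\<^esub> v x \<in> hom E (Dom E ?p) (Dom E (component p y))"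
        using ar by (simp_all add: hom_iff)
      show "component P y \<cdot>\<^bsub>E\<^esub> far Q f \<cdot>\<^bsub>E\<^esub> u x = ?d"
        using natural_extend[OF P f] u(2)[OF x] ar by simp
      show "component p y \<cdot>\<^bsub>E\<^esub> far W f \<cdot>\<^bsub>E\<^esub> v x = ?p"
        using natural_extend[OF p f] v(2)[OF x] ar by simp
      show "component q y \<cdot>\<^bsub>E\<^esub> far W f \<cdot>\<^bsub>E\<^esub> v x = (far Q f \<cdot>\<^bsub>E\<^esub> u x) \<cdot>\<^bsub>E\<^esub> ?q"
        using natural_extend[OF q f] v(3)[OF x] ar by (simp add: E.comp_assoc)
      show "component e y \<cdot>\<^bsub>E\<^esub> far W f \<cdot>\<^bsub>E\<^esub> v x = ?s"
        using natural_extend[OF e f] v(4)[OF x] ar by simp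
    qed
    moreover have "?try (u y \<cdot>\<^bsub>E\<^esub> far D f)"
      unfolding E.transposes_def
    proof (intro conjI bexI)
      show "u y \<cdot>\<^bsub>E\<^esub> far D f \<in> hom E (Dom E ?d) (Dom E (component P y))"
        "v y \<cdot>\<^bsub>E\<^esub> far V f \<in> hom E (Dom E ?p) (Dom E (component p y))"
        using ar by (simp_all add: hom_iff)
      show "component P y \<cdot>\<^bsub>E\<^esub> u y \<cdot>\<^bsub>E\<^esub> far D f = ?d"
        using E.comp_extend[OF u(2)[OF y], of "far D f"] F_hom_natural[OF d f] ar by simp
      show "component p y \<cdot>\<^bsub>E\<^esub> v y \<cdot>\<^bsub>E\<^esub> far V f = ?p"
        using E.comp_extend[OF v(2)[OF y], of "far V f"] F_hom_natural[OF p' f] ar by simp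
      show "component q y \<cdot>\<^bsub>E\<^esub> v y \<cdot>\<^bsub>E\<^esub> far V f = (u y \<cdot>\<^bsub>E\<^esub> far D f) \<cdot>\<^bsub>E\<^esub> ?q"
        using E.comp_extend[OF v(3)[OF y], of "far V f"] F_hom_natural[OF q' f] ar
        by (simp add: E.comp_assoc)
      show "component e y \<cdot>\<^bsub>E\<^esub> v y \<cdot>\<^bsub>E\<^esub> far V f = ?s"
        using E.comp_extend[OF v(4)[OF y], of "far V f"] F_hom_natural[OF s f] ar by simp
    qed
    \<comment> \<open>Both composites transpose \<open>C f \<circ> s\<^sub>x\<close>, which equals \<open>s\<^sub>y \<circ> V f\<close>.\<close>
    ultimately show "u y \<cdot>\<^bsub>E\<^esub> far D f = far Q f \<cdot>\<^bsub>E\<^esub> u x" by blast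
  qed
  let ?U = "(D, Q, restrict u (Ob J))"
  have PU: "P \<cdot>\<^bsub>F\<^esub> ?U = d"
    using u(2) by (intro F_hom_eqI[OF F_comp_hom[OF U P] d]) simp
  have hF: "is_pullback F h P p q" by (rule pointwise_pullback[OF h P p q pb])
  have "h \<cdot>\<^bsub>F\<^esub> p' = d \<cdot>\<^bsub>F\<^esub> q'"
    using E.is_pullbackD(9)[OF pb'] by (intro F_hom_eqI[OF F_comp_hom[OF p' h] F_comp_hom[OF q' d]]) simp
  then have "h \<cdot>\<^bsub>F\<^esub> p' = P \<cdot>\<^bsub>F\<^esub> ?U \<cdot>\<^bsub>F\<^esub> q'"
    using F.comp_extend[OF PU, of q'] U P q' by (simp add: hom_iff)
  \<comment> \<open>The natural transformation with components \<open>v\<close> is taken from the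
    pullback in the functor category and identified with \<open>v\<close> afterwards, so naturality
    of \<open>v\<close> needs no separate computation.\<close>
  then obtain t where t: "t \<in> hom F V W" "p \<cdot>\<^bsub>F\<^esub> t = p'" "q \<cdot>\<^bsub>F\<^esub> t = ?U \<cdot>\<^bsub>F\<^esub> q'"
    using F.pullback_lift[OF hF, of p' V "?U \<cdot>\<^bsub>F\<^esub> q'"] p' F_comp_hom[OF q' U] h P p
    unfolding hom_iff by metis
  have "component t x = v x" if x: "x \<in> Ob J" for x
  proof (rule E.pullback_eqI[OF pb[OF x]])
    show "component t x \<in> hom E (fob V x) (Dom E (component p x))"
      "v x \<in> hom E (fob V x) (Dom E (component p x))"
      using F_hom_component[OF t(1) x] v(1)[OF x] F_hom_component[OF p x] by (simp_all add: hom_iff)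
    show "component p x \<cdot>\<^bsub>E\<^esub> component t x = component p x \<cdot>\<^bsub>E\<^esub> v x"
      using t(2) v(2)[OF x] component_comp[OF x] by metis
    show "component q x \<cdot>\<^bsub>E\<^esub> component t x = component q x \<cdot>\<^bsub>E\<^esub> v x"
      using component_comp[OF x, of q t] x unfolding t(3) v(3)[OF x] by simp
  qed
  then have "e \<cdot>\<^bsub>F\<^esub> t = s"
    using v(4) by (intro F_hom_eqI[OF F_comp_hom[OF t(1) e] s]) simp
  moreover have "Dom F P = Q" "Dom F p = W" "Dom F d = D" "Dom F p' = V"
    using P p d p' by (simp_all add: hom_iff)
  ultimately have "F.transposes P p q e d p' q' s ?U"
    unfolding F.transposes_def using t U PU by auto
  moreover have "u' = ?U" if u': "F.transposes P p q e d p' q' s u'" for u'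
  proof (rule F_hom_eqI[OF _ U])
    show "u' \<in> hom F D Q" using u' d P unfolding F.transposes_def hom_iff by simp
    show "component u' x = component ?U x" if x: "x \<in> Ob J" for x
      using transposes_component[OF P p d p' u' x] tr[OF x] ex1[OF x] x by auto
  qed
  ultimately show ?thesis by blast
qed

text \<open>The data are arrows of the functor category but the universal property is demanded only
  at each object. In this form it survives precomposition, which says nothing about test objects of
  the smaller functor category.\<close>

definition pointwise_evaluation where
  "pointwise_evaluation h k P p q e \<longleftrightarrow> P \<in> hom F (Dom F P) (Cod F h) \<and>
     p \<in> hom F (Dom F p) (Dom F h) \<and> q \<in> hom F (Dom F p) (Dom F P) \<and>
     e \<in> hom F (Dom F p) (Dom F k) \<and>
     (\<forall>x\<in>Ob J. E.evaluation (component h x) (component k x) (component P x)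
        (component p x) (component q x) (component e x))"

text \<open>A test pullback in the functor category is not known to have pullback components. It is
  replaced by one assembled from pullbacks in \<open>E\<close>, where the objectwise argument
  applies, and the result is carried back by reindexing.\<close>

lemma evaluation_if_pointwise:
  assumes h: "h \<in> hom F B A" and k: "k \<in> hom F C B" and cart: "cartesian h"
    and pbs: "\<And>x. x \<in> Ob J \<Longrightarrow> pullbacks_along E (component h x)"
    and pev: "pointwise_evaluation h k P p q e"
  shows "F.evaluation h k P p q e"
proof -
  define Q W where "Q = Dom F P" and "W = Dom F p"
  have "Cod F h = A" "Dom F h = B" "Dom F k = C" using h k by (simp_all add: hom_iff)
  then have P: "P \<in> hom F Q A" and p: "p \<in> hom F W B" and q: "q \<in> hom F W Q"
    and e: "e \<in> hom F W C"
    and ev: "\<And>x. x \<in> Ob J \<Longrightarrow> E.evaluation (component h x) (component k x) (component P x)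
      (component p x) (component q x) (component e x)"
    using pev unfolding pointwise_evaluation_def Q_def W_def by simp_all
  have pb: "is_pullback F h P p q"
    using ev unfolding E.evaluation_def by (intro pointwise_pullback[OF h P p q]) blast
  have ke: "k \<cdot>\<^bsub>F\<^esub> e = p"
    using ev unfolding E.evaluation_def by (intro F_hom_eqI[OF F_comp_hom[OF e k] p]) simp
  have "\<exists>!u. F.transposes P p q e d p' q' s u"
    if pb': "is_pullback F h d p' q'" and s: "s \<in> hom F (Dom F p') (Dom F k)" "k \<cdot>\<^bsub>F\<^esub> s = p'"
    for d p' q' s
  proof -
    have d: "d \<in> hom F (Dom F d) A" using F.is_pullbackD[OF pb'] h by (simp add: hom_iff)
    have "\<exists>p q. is_pullback E (component h x) (component d x) p q" if "x \<in> Ob J" for x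
      using pbs[OF that] F_hom_component[OF d that] F_hom_component[OF h that]
      unfolding pullbacks_along_def hom_iff by metis
    then obtain p0 q0 where
      pb0: "\<And>x. x \<in> Ob J \<Longrightarrow> is_pullback E (component h x) (component d x) (p0 x) (q0 x)"
      by metis
    from extend_pointwise_pullback[OF h d this] obtain V p1 q1 where
      p1: "p1 \<in> hom F V B" and q1: "q1 \<in> hom F V (Dom F d)"
      and c: "\<And>x. x \<in> Ob J \<Longrightarrow> component p1 x = p0 x" "\<And>x. x \<in> Ob J \<Longrightarrow> component q1 x = q0 x"
      and pb1: "is_pullback F h d p1 q1"
      by metis
    show ?thesis
    proof (rule F.ex1_transposes_reindex[OF pb pb1 pb' _ _ _ _ s])
      show "e \<in> hom F (Dom F p) (Dom F k)" "k \<in> Ar F" "Cod F k = Dom F h"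
        using e p k h by (simp_all add: hom_iff)
      fix s
      assume "s \<in> hom F (Dom F p1) (Dom F k)" "k \<cdot>\<^bsub>F\<^esub> s = p1"
      then have "s \<in> hom F V C" "k \<cdot>\<^bsub>F\<^esub> s = p1" using p1 k by (simp_all add: hom_iff)
      from ex1_transposes_pointwise[OF h k P p q e cart ev d p1 q1 this] pb0 c
      show "\<exists>!u. F.transposes P p q e d p1 q1 s u" by simp
    qed
  qed
  then show ?thesis
    unfolding F.evaluation_def using pb k h e p ke by (auto simp: hom_iff)
qed

text \<open>Evaluations are chosen at each object without coordination. The universal properties
  then force the action of the product on arrows, and the pullback legs and the counits turn out to
  be natural for it.\<close>

lemma pointwise_evaluation_exists:
  assumes h: "h \<in> hom F B A" and k: "k \<in> hom F C B" and cart: "cartesian h"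
    and pow: "\<And>x. x \<in> Ob J \<Longrightarrow> powerful E (component h x)"
  obtains P p q e where "pointwise_evaluation h k P p q e"
proof -
  have "\<exists>P p q e. E.evaluation (component h x) (component k x) P p q e" if x: "x \<in> Ob J" for x
  proof -
    have "component k x \<in> Ar E" "Cod E (component k x) = Dom E (component h x)"
      using F_hom_component[OF h x] F_hom_component[OF k x] by (simp_all add: hom_iff)
    then show ?thesis
      using E.dependent_product_of_powerful[OF pow[OF x]] E.evaluation_of_dependent_product by metis
  qed
  then obtain P0 p0 q0 e0 where
    ev: "\<And>x. x \<in> Ob J \<Longrightarrow>
      E.evaluation (component h x) (component k x) (P0 x) (p0 x) (q0 x) (e0 x)"
    by metis
  have pb: "is_pullback E (component h x) (P0 x) (p0 x) (q0 x)"
    and e0': "e0 x \<in> hom E (Dom E (p0 x)) (Dom E (component k x))" and ke: "component k x \<cdot>\<^bsub>E\<^esub> e0 x = p0 x"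
    and univ: "\<And>d p' q' s. is_pullback E (component h x) d p' q' \<Longrightarrow>
      s \<in> hom E (Dom E p') (Dom E (component k x)) \<Longrightarrow> component k x \<cdot>\<^bsub>E\<^esub> s = p' \<Longrightarrow>
      \<exists>!u. E.transposes (P0 x) (p0 x) (q0 x) (e0 x) d p' q' s u"
    if x: "x \<in> Ob J" for x
    using ev[OF x] unfolding E.evaluation_def by blast+
  have e0: "e0 x \<in> hom E (Dom E (p0 x)) (fob C x)" if "x \<in> Ob J" for x
    using e0'[OF that] F_hom_component[OF k that] by (simp add: hom_iff)
  have P0: "P0 x \<in> hom E (Dom E (P0 x)) (fob A x)" and p0: "p0 x \<in> hom E (Dom E (p0 x)) (fob B x)"
    and q0: "q0 x \<in> hom E (Dom E (p0 x)) (Dom E (P0 x))"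
    if "x \<in> Ob J" for x
    using E.is_pullbackD[OF pb[OF that]] F_hom_component[OF h that] by (simp_all add: hom_iff)
  note A = F_hom_functor(2)[OF h] and B = F_hom_functor(1)[OF h] and C = F_hom_functor(1)[OF k]
  \<comment> \<open>The action of the product on \<open>f : x \<rightarrow> y\<close> transposes \<open>C f \<circ> e\<^sub>x\<close> along \<open>h\<^sub>y\<close>; this typechecks since, \<open>h\<close>
    being cartesian, \<open>h\<^sub>y\<^sup>*\<close> of \<open>A f \<circ> P\<^sub>x\<close> is again \<open>h\<^sub>x\<^sup>* P\<^sub>x\<close>.\<close>
  let ?R = "\<lambda>f u. E.transposes (P0 (Cod J f)) (p0 (Cod J f)) (q0 (Cod J f)) (e0 (Cod J f))
    (far A f \<cdot>\<^bsub>E\<^esub> P0 (Dom J f)) (far B f \<cdot>\<^bsub>E\<^esub> p0 (Dom J f)) (q0 (Dom J f)) (far C f \<cdot>\<^bsub>E\<^esub> e0 (Dom J f)) u"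
  have R_iff: "?R f u \<longleftrightarrow> u \<in> hom E (Dom E (P0 x)) (Dom E (P0 y)) \<and>
      P0 y \<cdot>\<^bsub>E\<^esub> u = far A f \<cdot>\<^bsub>E\<^esub> P0 x \<and>
      (\<exists>v. v \<in> hom E (Dom E (p0 x)) (Dom E (p0 y)) \<and> p0 y \<cdot>\<^bsub>E\<^esub> v = far B f \<cdot>\<^bsub>E\<^esub> p0 x \<and>
        q0 y \<cdot>\<^bsub>E\<^esub> v = u \<cdot>\<^bsub>E\<^esub> q0 x \<and> e0 y \<cdot>\<^bsub>E\<^esub> v = far C f \<cdot>\<^bsub>E\<^esub> e0 x)"
    if f: "f \<in> hom J x y" for f x y u
  proof -
    have x: "x \<in> Ob J" using J.hom_Ob[OF f] by auto
    have "Dom E (far A f \<cdot>\<^bsub>E\<^esub> P0 x) = Dom E (P0 x)" "Dom E (far B f \<cdot>\<^bsub>E\<^esub> p0 x) = Dom E (p0 x)"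
      using P0[OF x] p0[OF x] functorD(1)[OF A f] functorD(1)[OF B f] by (simp_all add: hom_iff)
    then show ?thesis using f unfolding E.transposes_def by (auto simp: hom_iff[of f])
  qed
  obtain Q where Q: "is_functor J E Q" "\<And>x. x \<in> Ob J \<Longrightarrow> fob Q x = Dom E (P0 x)"
    "\<And>f x y. f \<in> hom J x y \<Longrightarrow> ?R f (far Q f)"
  proof (rule functor_from_relation[where obj = "\<lambda>x. Dom E (P0 x)" and R = ?R])
    fix x assume x: "x \<in> Ob J"
    show "Dom E (P0 x) \<in> Ob E" using P0[OF x] by (simp add: hom_iff)
    show "?R (Ident J x) (Ident E (Dom E (P0 x)))"
      unfolding R_iff[OF J.Ident_hom[OF x]]
      using P0[OF x] p0[OF x] q0[OF x] e0[OF x] functorD(3)[OF A x] functorD(3)[OF B x]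
        functorD(3)[OF C x]
      by (intro conjI exI[of _ "Ident E (Dom E (p0 x))"]) (simp_all add: hom_iff)
  next
    fix f x y assume f: "f \<in> hom J x y"
    have x: "x \<in> Ob J" and y: "y \<in> Ob J" using J.hom_Ob[OF f] by auto
    note ar = P0[OF x] P0[OF y] p0[OF x] e0[OF x] functorD(1)[OF A f] functorD(1)[OF B f]
      functorD(1)[OF C f] F_hom_component[OF k x] F_hom_component[OF k y]
    have "component k y \<cdot>\<^bsub>E\<^esub> far C f \<cdot>\<^bsub>E\<^esub> e0 x = far B f \<cdot>\<^bsub>E\<^esub> p0 x"
      using natural_extend[OF k f, of "e0 x"] ke[OF x] ar by (simp add: hom_iff)
    moreover have "far C f \<cdot>\<^bsub>E\<^esub> e0 x \<in> hom E (Dom E (far B f \<cdot>\<^bsub>E\<^esub> p0 x)) (Dom E (component k y))"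
      using ar by (simp add: hom_iff)
    ultimately have "\<exists>!u. ?R f u"
      using univ[OF y E.pullback_pasting[OF cartesianD[OF cart h f] pb[OF x]]] f
      by (simp add: hom_iff[of f])
    then show "\<exists>!u. u \<in> hom E (Dom E (P0 x)) (Dom E (P0 y)) \<and> ?R f u"
      using R_iff[OF f] by blast
  next
    fix f g x y z u w
    assume f: "f \<in> hom J x y" and g: "g \<in> hom J y z" and Rf: "?R f u" and Rg: "?R g w"
    have x: "x \<in> Ob J" and y: "y \<in> Ob J" and z: "z \<in> Ob J" using J.hom_Ob f g by auto
    obtain v where u: "u \<in> hom E (Dom E (P0 x)) (Dom E (P0 y))" "P0 y \<cdot>\<^bsub>E\<^esub> u = far A f \<cdot>\<^bsub>E\<^esub> P0 x"
      and v: "v \<in> hom E (Dom E (p0 x)) (Dom E (p0 y))" "p0 y \<cdot>\<^bsub>E\<^esub> v = far B f \<cdot>\<^bsub>E\<^esub> p0 x"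
        "q0 y \<cdot>\<^bsub>E\<^esub> v = u \<cdot>\<^bsub>E\<^esub> q0 x" "e0 y \<cdot>\<^bsub>E\<^esub> v = far C f \<cdot>\<^bsub>E\<^esub> e0 x"
      using Rf unfolding R_iff[OF f] by blast
    obtain v' where w: "w \<in> hom E (Dom E (P0 y)) (Dom E (P0 z))" "P0 z \<cdot>\<^bsub>E\<^esub> w = far A g \<cdot>\<^bsub>E\<^esub> P0 y"
      and v': "v' \<in> hom E (Dom E (p0 y)) (Dom E (p0 z))" "p0 z \<cdot>\<^bsub>E\<^esub> v' = far B g \<cdot>\<^bsub>E\<^esub> p0 y"
        "q0 z \<cdot>\<^bsub>E\<^esub> v' = w \<cdot>\<^bsub>E\<^esub> q0 y" "e0 z \<cdot>\<^bsub>E\<^esub> v' = far C g \<cdot>\<^bsub>E\<^esub> e0 y"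
      using Rg unfolding R_iff[OF g] by blast
    \<comment> \<open>This covers structure maps, first legs and counits, whose targets are the
      functors \<open>A\<close>, \<open>B\<close> and \<open>C\<close>. The vertices form a bare
      family \<open>c\<close> because no functor on them exists yet; for the same reason the second
      leg, whose target is such a family, is treated separately.\<close>
    have chain: "r z \<cdot>\<^bsub>E\<^esub> b \<cdot>\<^bsub>E\<^esub> a = far S (g \<cdot>\<^bsub>J\<^esub> f) \<cdot>\<^bsub>E\<^esub> r x"
      if S: "is_functor J E S" and r: "\<And>x. x \<in> Ob J \<Longrightarrow> r x \<in> hom E (c x) (fob S x)"
        and a: "a \<in> hom E (c x) (c y)" "r y \<cdot>\<^bsub>E\<^esub> a = far S f \<cdot>\<^bsub>E\<^esub> r x"
        and b: "b \<in> hom E (c y) (c z)" "r z \<cdot>\<^bsub>E\<^esub> b = far S g \<cdot>\<^bsub>E\<^esub> r y" for r S a b c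
      using r[OF x] r[OF y] r[OF z] a b(1) functorD(1)[OF S f] functorD(1)[OF S g]
      by (simp add: functorD(4)[OF S f g] E.comp_extend[OF b(2)] E.comp_assoc hom_iff)
    have "q0 z \<cdot>\<^bsub>E\<^esub> v' \<cdot>\<^bsub>E\<^esub> v = (w \<cdot>\<^bsub>E\<^esub> u) \<cdot>\<^bsub>E\<^esub> q0 x"
      using q0[OF x] q0[OF y] q0[OF z] u(1) v(1,3) w(1) v'(1)
      by (simp add: E.comp_extend[OF v'(3)] E.comp_assoc hom_iff)
    then show "?R (g \<cdot>\<^bsub>J\<^esub> f) (w \<cdot>\<^bsub>E\<^esub> u)"
      unfolding R_iff[OF J.comp_hom[OF f g]]
      using chain[OF A P0 u w] chain[OF B p0 v(1,2) v'(1,2)] chain[OF C e0 v(1,4) v'(1,4)]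
        E.comp_hom[OF u(1) w(1)] E.comp_hom[OF v(1) v'(1)] by blast
  qed (rule that)
  let ?P = "(Q, A, restrict P0 (Ob J))"
  have "P0 y \<cdot>\<^bsub>E\<^esub> far Q f = far A f \<cdot>\<^bsub>E\<^esub> P0 x" if f: "f \<in> hom J x y" for f x y
    using Q(3)[OF f] unfolding R_iff[OF f] by blast
  then have P: "?P \<in> hom F Q A" using P0 Q(2) by (intro F_homI[OF Q(1) A]) simp_all
  have pbP: "is_pullback E (component h x) (component ?P x) (p0 x) (q0 x)" if "x \<in> Ob J" for x
    using pb[OF that] that by simp
  obtain W p q where p: "p \<in> hom F W B" "\<And>x. x \<in> Ob J \<Longrightarrow> component p x = p0 x"
    and q: "q \<in> hom F W Q" "\<And>x. x \<in> Ob J \<Longrightarrow> component q x = q0 x"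
    using extend_pointwise_pullback[OF h P pbP] by metis
  have W: "fob W x = Dom E (p0 x)" if "x \<in> Ob J" for x
    using F_hom_component[OF p(1) that] p(2)[OF that] by (simp add: hom_iff)
  let ?e = "(W, C, restrict e0 (Ob J))"
  have e: "?e \<in> hom F W C"
  proof (rule F_homI[OF F_hom_functor(1)[OF p(1)] C])
    show "e0 x \<in> hom E (fob W x) (fob C x)" if "x \<in> Ob J" for x using e0 W that by simp
    fix f x y assume f: "f \<in> hom J x y"
    have x: "x \<in> Ob J" and y: "y \<in> Ob J" using J.hom_Ob[OF f] by auto
    obtain v where v: "v \<in> hom E (Dom E (p0 x)) (Dom E (p0 y))" "p0 y \<cdot>\<^bsub>E\<^esub> v = far B f \<cdot>\<^bsub>E\<^esub> p0 x"
        "q0 y \<cdot>\<^bsub>E\<^esub> v = far Q f \<cdot>\<^bsub>E\<^esub> q0 x" "e0 y \<cdot>\<^bsub>E\<^esub> v = far C f \<cdot>\<^bsub>E\<^esub> e0 x"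
      using Q(3)[OF f] unfolding R_iff[OF f] by blast
    \<comment> \<open>The witness that \<open>far Q f\<close> is a transpose satisfies the two leg
      equations that determine \<open>far W f\<close>. Its remaining equation is then naturality of
      the counit.\<close>
    have "far W f = v"
    proof (rule E.pullback_eqI[OF pb[OF y] _ v(1)])
      show "far W f \<in> hom E (Dom E (p0 x)) (Dom E (p0 y))"
        using functorD(1)[OF F_hom_functor(1)[OF p(1)] f] W x y by simp
      show "p0 y \<cdot>\<^bsub>E\<^esub> far W f = p0 y \<cdot>\<^bsub>E\<^esub> v" "q0 y \<cdot>\<^bsub>E\<^esub> far W f = q0 y \<cdot>\<^bsub>E\<^esub> v"
        using F_hom_natural[OF p(1) f] F_hom_natural[OF q(1) f] p(2) q(2) x y v by simp_all
    qed
    then show "e0 y \<cdot>\<^bsub>E\<^esub> far W f = far C f \<cdot>\<^bsub>E\<^esub> e0 x" using v(4) by simp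
  qed
  have "pointwise_evaluation h k ?P p q ?e"
    unfolding pointwise_evaluation_def using P p q e h k ev by (simp add: hom_iff)
  then show ?thesis by (rule that)
qed

end

section \<open>Precomposition\<close>

text \<open>\<open>dom\<close> and \<open>cod\<close> refer to the source and target of
  \<open>pre\<close>, which is contravariant in the index category: \<open>K\<close> goes from
  \<open>J'\<close> to \<open>J\<close>.\<close>

locale precomposition =
  dom: functor_category J E + cod: functor_category J' E
  for J :: "('i, 'j) cat" and J' :: "('i2, 'j2) cat" and E :: "('o, 'm) cat" +
  fixes K :: "('i2, 'j2, 'i, 'j) func"
  assumes K: "is_functor J' J K"
begin

abbreviation pre where "pre \<equiv> precompose J' J E K"

lemma K_hom: "f \<in> hom J' x y \<Longrightarrow> far K f \<in> hom J (fob K x) (fob K y)"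
  and K_Ob: "x \<in> Ob J' \<Longrightarrow> fob K x \<in> Ob J"
  and K_Ident: "x \<in> Ob J' \<Longrightarrow> far K (Ident J' x) = Ident J (fob K x)"
  and K_comp: "f \<in> hom J' x y \<Longrightarrow> g \<in> hom J' y z \<Longrightarrow>
    far K (g \<cdot>\<^bsub>J'\<^esub> f) = far K g \<cdot>\<^bsub>J\<^esub> far K f"
  using K unfolding is_functor_def by blast+

lemma fob_pre:
  assumes "is_functor J E G"
  shows "fob pre G = functor_comp J' G K"
  using assms by (simp add: precompose_def functor_cat_def)

lemma far_pre:
  assumes "t \<in> hom dom.F G H"
  shows "far pre t = (fob pre G, fob pre H, \<lambda>x\<in>Ob J'. component t (fob K x))"
proof -
  obtain \<eta> where "t = (G, H, \<eta>)" using assms unfolding dom.F_hom_iff by blast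
  with assms show ?thesis
    by (simp add: precompose_def fob_pre[OF dom.F_hom_functor(1)] hom_iff functor_cat_def nat_trans_def)
qed

lemma component_far_pre [simp]:
  "t \<in> hom dom.F G H \<Longrightarrow> x \<in> Ob J' \<Longrightarrow> component (far pre t) x = component t (fob K x)"
  by (simp add: far_pre)

lemma fob_fob_pre [simp]: "is_functor J E G \<Longrightarrow> x \<in> Ob J' \<Longrightarrow> fob (fob pre G) x = fob G (fob K x)"
  and far_fob_pre [simp]: "is_functor J E G \<Longrightarrow> f \<in> hom J' x y \<Longrightarrow> far (fob pre G) f = far G (far K f)"
  by (simp_all add: fob_pre functor_comp_def hom_iff)

lemma is_functor_fob_pre:
  assumes G: "is_functor J E G"
  shows "is_functor J' E (fob pre G)"
  unfolding is_functor_def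
proof (intro conjI ballI allI impI)
  show "fob (fob pre G) \<in> extensional (Ob J')" "far (fob pre G) \<in> extensional (Ar J')"
    by (simp_all add: fob_pre[OF G] functor_comp_def)
  show "fob (fob pre G) x \<in> Ob E" if "x \<in> Ob J'" for x
    using dom.functorD(2)[OF G K_Ob[OF that]] G that by simp
  show "far (fob pre G) f \<in> hom E (fob (fob pre G) x) (fob (fob pre G) y)"
    if "f \<in> hom J' x y" for x y f
    using dom.functorD(1)[OF G K_hom[OF that]] G that cod.J.hom_Ob[OF that] by simp
  show "far (fob pre G) (Ident J' x) = Ident E (fob (fob pre G) x)" if "x \<in> Ob J'" for x
    using dom.functorD(3)[OF G K_Ob[OF that]] G that K_Ident[OF that]
      far_fob_pre[OF G cod.J.Ident_hom[OF that]] by simp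
  fix x y z f g
  assume "f \<in> hom J' x y \<and> g \<in> hom J' y z"
  then have f: "f \<in> hom J' x y" and g: "g \<in> hom J' y z" by auto
  show "far (fob pre G) (g \<cdot>\<^bsub>J'\<^esub> f) = far (fob pre G) g \<cdot>\<^bsub>E\<^esub> far (fob pre G) f"
    using dom.functorD(4)[OF G K_hom[OF f] K_hom[OF g]] far_fob_pre[OF G cod.J.comp_hom[OF f g]]
      far_fob_pre[OF G f] far_fob_pre[OF G g] K_comp[OF f g] by simp
qed

lemma far_pre_hom:
  assumes t: "t \<in> hom dom.F G H"
  shows "far pre t \<in> hom cod.F (fob pre G) (fob pre H)"
  unfolding far_pre[OF t]
proof (rule cod.F_homI)
  note G = dom.F_hom_functor(1)[OF t] and H = dom.F_hom_functor(2)[OF t]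
  show "is_functor J' E (fob pre G)" "is_functor J' E (fob pre H)"
    using is_functor_fob_pre G H by blast+
  show "component t (fob K x) \<in> hom E (fob (fob pre G) x) (fob (fob pre H) x)" if "x \<in> Ob J'" for x
    using dom.F_hom_component[OF t K_Ob[OF that]] G H that by simp
  show "component t (fob K y) \<cdot>\<^bsub>E\<^esub> far (fob pre G) f = far (fob pre H) f \<cdot>\<^bsub>E\<^esub> component t (fob K x)"
    if f: "f \<in> hom J' x y" for x y f
    using dom.F_hom_natural[OF t K_hom[OF f]] far_fob_pre[OF G f] far_fob_pre[OF H f] by simp
qed

text \<open>Functoriality lets isomorphisms of the slice over \<open>A\<close> be carried to the
  slice over \<open>fob pre A\<close>.\<close>

lemma is_functor_pre: "is_functor dom.F cod.F pre"
  unfolding is_functor_def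
proof (intro conjI ballI allI impI)
  show "fob pre \<in> extensional (Ob dom.F)" "far pre \<in> extensional (Ar dom.F)"
    by (simp_all add: precompose_def)
  show ob: "fob pre G \<in> Ob cod.F" if "G \<in> Ob dom.F" for G
    using that is_functor_fob_pre by (simp add: functor_cat_def)
  show "far pre t \<in> hom cod.F (fob pre G) (fob pre H)" if "t \<in> hom dom.F G H" for t G H
    using far_pre_hom[OF that] .
  show "far pre (Ident dom.F G) = Ident cod.F (fob pre G)" if G: "G \<in> Ob dom.F" for G
  proof (rule cod.F_hom_eqI[OF far_pre_hom[OF dom.F.Ident_hom[OF G]] cod.F.Ident_hom[OF ob[OF G]]])
    fix x assume x: "x \<in> Ob J'"
    have "is_functor J E G" using G by (simp add: functor_cat_def)
    then show "component (far pre (Ident dom.F G)) x = component (Ident cod.F (fob pre G)) x"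
      using component_far_pre[OF dom.F.Ident_hom[OF G] x] K_Ob[OF x] x by simp
  qed
  fix G H L s t
  assume "s \<in> hom dom.F G H \<and> t \<in> hom dom.F H L"
  then have s: "s \<in> hom dom.F G H" and t: "t \<in> hom dom.F H L" by auto
  show "far pre (t \<cdot>\<^bsub>dom.F\<^esub> s) = far pre t \<cdot>\<^bsub>cod.F\<^esub> far pre s"
    using component_far_pre[OF s] component_far_pre[OF t] component_far_pre[OF dom.F_comp_hom[OF s t]]
      K_Ob
    by (intro cod.F_hom_eqI[OF far_pre_hom[OF dom.F_comp_hom[OF s t]]
          cod.F_comp_hom[OF far_pre_hom[OF s] far_pre_hom[OF t]]]) simp
qed

lemma cartesian_pre:
  assumes h: "h \<in> hom dom.F B A" and cart: "dom.cartesian h"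
  shows "cod.cartesian (far pre h)"
  unfolding cod.cartesian_def
proof (intro allI ballI)
  fix x y f
  assume f: "f \<in> hom J' x y"
  have "Cod cod.F (far pre h) = fob pre A" "Dom cod.F (far pre h) = fob pre B"
    using far_pre_hom[OF h] by (simp_all add: hom_iff)
  then show "is_pullback E (component (far pre h) y) (far (Cod cod.F (far pre h)) f)
      (far (Dom cod.F (far pre h)) f) (component (far pre h) x)"
    using dom.cartesianD[OF cart h K_hom[OF f]] cod.J.hom_Ob[OF f] h f
      far_fob_pre[OF dom.F_hom_functor(1)[OF h] f] far_fob_pre[OF dom.F_hom_functor(2)[OF h] f]
    by simp
qed

text \<open>The component at \<open>x\<close> of a restricted arrow is the component of the original
  at \<open>fob K x\<close>, so each condition at \<open>x\<close> is literally one of the given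
  conditions. This works for any functor \<open>K\<close>.\<close>

lemma pointwise_evaluation_pre:
  assumes h: "h \<in> hom dom.F B A" and k: "k \<in> hom dom.F C B"
    and pev: "dom.pointwise_evaluation h k P p q e"
  shows "cod.pointwise_evaluation (far pre h) (far pre k) (far pre P) (far pre p) (far pre q)
    (far pre e)"
proof -
  have *: "P \<in> hom dom.F (Dom dom.F P) (Cod dom.F h)" "p \<in> hom dom.F (Dom dom.F p) (Dom dom.F h)"
    "q \<in> hom dom.F (Dom dom.F p) (Dom dom.F P)" "e \<in> hom dom.F (Dom dom.F p) (Dom dom.F k)"
    using pev unfolding dom.pointwise_evaluation_def by blast+
  have "Dom cod.F (far pre P) = fob pre (Dom dom.F P)" "Dom cod.F (far pre p) = fob pre (Dom dom.F p)"
    "Dom cod.F (far pre h) = fob pre (Dom dom.F h)" "Cod cod.F (far pre h) = fob pre (Cod dom.F h)"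
    "Dom cod.F (far pre k) = fob pre (Dom dom.F k)"
    using *(1,2)[THEN far_pre_hom] far_pre_hom[OF h] far_pre_hom[OF k] h k
    by (simp_all add: hom_iff)
  then show ?thesis
    using *[THEN far_pre_hom] pev K_Ob
    unfolding dom.pointwise_evaluation_def cod.pointwise_evaluation_def
    by (simp add: component_far_pre[OF h] component_far_pre[OF k] *[THEN component_far_pre])
qed

end

section \<open>Comparing dependent products over \<open>\<G>\<close> and over
  \<open>\<C>\<close>\<close>

theorem theorem1p8:
  fixes \<E> :: "('eo, 'em) cat" and \<C> :: "('co, 'cm) cat"
  defines "\<G> \<equiv> localisation \<C>"
  defines "\<gamma>s \<equiv> precompose \<C> \<G> \<E> (localisation_functor \<C>)"
  assumes "category \<E>" and "category \<C>"
    and "h \<in> hom (functor_cat \<G> \<E>) B A"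
    and "\<forall>x\<in>Ob \<G>. powerful \<E> (component h x)"
  shows "\<forall>C. \<forall>k \<in> hom (functor_cat \<G> \<E>) C B.
     (\<exists>P. dependent_product (functor_cat \<G> \<E>) h k P) \<and>
     (\<exists>Q. dependent_product (functor_cat \<C> \<E>) (far \<gamma>s h) (far \<gamma>s k) Q) \<and>
     (\<forall>P Q. dependent_product (functor_cat \<G> \<E>) h k P \<longrightarrow>
            dependent_product (functor_cat \<C> \<E>) (far \<gamma>s h) (far \<gamma>s k) Q \<longrightarrow>
            isomorphic (slice (functor_cat \<C> \<E>) (fob \<gamma>s A)) Q (far \<gamma>s P))"
proof (intro allI ballI)
  fix C k
  assume k: "k \<in> hom (functor_cat \<G> \<E>) C B"
  note h = assms(5)
  interpret precomposition \<G> \<C> \<E> "localisation_functor \<C>"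
    unfolding \<G>_def using assms(3,4)
    by (intro precomposition.intro precomposition_axioms.intro functor_category.intro cat.intro
        category_localisation is_functor_localisation_functor)
  interpret S: cat "slice cod.F (fob pre A)" by (rule cat.intro[OF cod.F.category_slice])
  have "\<exists>g. inverse_arrows \<G> f g" if "f \<in> hom \<G> x y" for x y f
    using localisation_inverse[OF assms(4)] that unfolding \<G>_def by metis
  then have cart: "dom.cartesian h" by (rule dom.cartesian_if_invertible[OF h])
  have pow: "powerful \<E> (component h x)" if "x \<in> Ob \<G>" for x using assms(6) that by blast
  then have pbs: "pullbacks_along \<E> (component h x)" if "x \<in> Ob \<G>" for x
    using that unfolding powerful_def by blast
  then have pbs': "pullbacks_along \<E> (component (far pre h) x)" if "x \<in> Ob \<C>" for x
    using component_far_pre[OF h that] K_Ob[OF that] by simp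
  note h' = far_pre_hom[OF h] and k' = far_pre_hom[OF k]
  obtain P0 p q e where pev: "dom.pointwise_evaluation h k P0 p q e"
    by (rule dom.pointwise_evaluation_exists[OF h k cart pow])
  have P0: "dependent_product dom.F h k P0"
    by (rule dom.F.dependent_product_of_evaluation[OF dom.pullbacks_along_pointwise[OF h pbs]
          dom.evaluation_if_pointwise[OF h k cart pbs pev]])
  have Q0: "dependent_product cod.F (far pre h) (far pre k) (far pre P0)"
    by (rule cod.F.dependent_product_of_evaluation[OF cod.pullbacks_along_pointwise[OF h' pbs']
          cod.evaluation_if_pointwise[OF h' k' cartesian_pre[OF h cart] pbs'
            pointwise_evaluation_pre[OF h k pev]]])
  \<comment> \<open>Dependent products are fixed only up to isomorphism, so arbitrary
    \<open>P\<close> and \<open>Q\<close> are compared through the constructed \<open>P0\<close>: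
    uniqueness over \<open>\<C>\<close> relates \<open>Q\<close> to the image of \<open>P0\<close>,
    and uniqueness over \<open>\<G>\<close>, carried along \<open>pre\<close>, relates that image to
    the image of \<open>P\<close>.\<close>
  have "isomorphic (slice cod.F (fob pre A)) Q (far pre P)"
    if P: "dependent_product dom.F h k P" and Q: "dependent_product cod.F (far pre h) (far pre k) Q"
    for P Q
  proof (rule S.isomorphic_trans)
    show "isomorphic (slice cod.F (fob pre A)) Q (far pre P0)"
      using cod.F.dependent_product_unique[OF Q Q0] h' by (simp add: hom_iff)
    have "isomorphic (slice dom.F A) P0 P"
      using dom.F.dependent_product_unique[OF P0 P] h by (simp add: hom_iff)
    then show "isomorphic (slice cod.F (fob pre A)) (far pre P0) (far pre P)"
      by (rule dom.F.isomorphic_slice_image[OF is_functor_pre])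
  qed
  then show "(\<exists>P. dependent_product dom.F h k P) \<and>
     (\<exists>Q. dependent_product cod.F (far \<gamma>s h) (far \<gamma>s k) Q) \<and>
     (\<forall>P Q. dependent_product dom.F h k P \<longrightarrow>
            dependent_product cod.F (far \<gamma>s h) (far \<gamma>s k) Q \<longrightarrow>
            isomorphic (slice cod.F (fob \<gamma>s A)) Q (far \<gamma>s P))"
    using P0 Q0 unfolding \<gamma>s_def by blast
qed

end
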